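(* Let $T\subset\mathbb R^3$ be a connected self-affine lattice tile such that $T+\mathbb Z^3$ is a tiling of $\mathbb R^3$, and suppose $T$ has a symmetry center $c$ (i.e. $2c-T=T$) which is not an interior point of $T$. Then the interior of $T$ is not simply connected. In particular, the interiors of the twindragons $\mathcal D=T_{0,1}$ and $\mathcal E=T_{2,-2}$ are not simply connected, and $\mathcal D$ and $\mathcal E$ are not homeomorphic to a closed ball.
   Context: A self-affine lattice tile: $M$ an integer $3\times3$ matrix with all eigenvalues of modulus $>1$, $m=|\det M|$, $k_1,\dots,k_m\in\mathbb R^3$ with $k_j-k_1\in\mathbb Z^3$ forming a complete set of residues of $\mathbb Z^3$ modulo $M\mathbb Z^3$, $f_j(x)=M^{-1}(x+k_j)$, $T=\bigcup_j f_j(T)$ compact nonempty. Twindragons: for integers $a,b$ let $M_{a,b}=\begin{pmatrix}0&0&2\\1&0&b\\0&1&a\end{pmatrix}$ (characteristic polynomial $-\lambda^3+a\lambda^2+b\lambda+2$), $e_1=(1,0,0)'$, $f_1(x)=M_{a,b}^{-1}(x-\tfrac12 e_1)$, $f_2(x)=M_{a,b}^{-1}(x+\tfrac12 e_1)$, and $T_{a,b}$ the compact set with $T_{a,b}=f_1(T_{a,b})\cup f_2(T_{a,b})$. For $(a,b)=(0,1)$ and $(2,-2)$ all eigenvalues of $M_{a,b}$ have modulus $>1$, $T_{a,b}$ is connected, $T_{a,b}+\mathbb Z^3$ is a tiling, and $T_{a,b}=-T_{a,b}$ (center $0$). *)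

theory Defs
  imports "HOL-Analysis.Analysis"
begin

definition Zlat :: "(real^3) set" where
  "Zlat = {x. \<forall>i. x $ i \<in> \<int>}"

definition integer_matrix :: "real^3^3 \<Rightarrow> bool" where
  "integer_matrix M \<longleftrightarrow> (\<forall>i j. M $ i $ j \<in> \<int>)"

definition expanding :: "real^3^3 \<Rightarrow> bool" where
  "expanding M \<longleftrightarrow>
     (\<forall>z::complex. det (mat z - (\<chi> i j. complex_of_real (M $ i $ j))) = 0 \<longrightarrow> 1 < cmod z)"

definition digit_set :: "real^3^3 \<Rightarrow> (real^3) set \<Rightarrow> bool" where
  "digit_set M D \<longleftrightarrow> finite D \<and> real (card D) = \<bar>det M\<bar> \<and>
     (\<exists>k1\<in>D. (\<forall>k\<in>D. k - k1 \<in> Zlat) \<and>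
        (\<forall>z\<in>Zlat. \<exists>!k\<in>D. z - (k - k1) \<in> (\<lambda>y. M *v y) ` Zlat))"

definition self_affine_lattice_tile :: "(real^3) set \<Rightarrow> bool" where
  "self_affine_lattice_tile T \<longleftrightarrow>
     (\<exists>M D. integer_matrix M \<and> expanding M \<and> digit_set M D \<and>
        compact T \<and> T \<noteq> {} \<and>
        T = (\<Union>k\<in>D. (\<lambda>x. matrix_inv M *v (x + k)) ` T))"

definition lattice_tiling :: "(real^3) set \<Rightarrow> bool" where
  "lattice_tiling T \<longleftrightarrow>
     (\<Union>z\<in>Zlat. (\<lambda>x. x + z) ` T) = UNIV \<and>
     (\<forall>z\<in>Zlat. \<forall>z'\<in>Zlat. z \<noteq> z' \<longrightarrow>
        interior ((\<lambda>x. x + z) ` T) \<inter> interior ((\<lambda>x. x + z') ` T) = {})"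

definition twin_matrix :: "int \<Rightarrow> int \<Rightarrow> real^3^3" where
  "twin_matrix a b = vector [vector [0, 0, 2], vector [1, 0, of_int b], vector [0, 1, of_int a]]"

definition e1 :: "real^3" where
  "e1 = vector [1, 0, 0]"

definition is_twindragon :: "int \<Rightarrow> int \<Rightarrow> (real^3) set \<Rightarrow> bool" where
  "is_twindragon a b T \<longleftrightarrow> compact T \<and> T \<noteq> {} \<and>
     T = (\<lambda>x. matrix_inv (twin_matrix a b) *v (x - (1/2) *\<^sub>R e1)) ` T
       \<union> (\<lambda>x. matrix_inv (twin_matrix a b) *v (x + (1/2) *\<^sub>R e1)) ` T"

end

theory Submission
  imports Defs
    "HOL-Complex_Analysis.Riemann_Mapping"
    "HOL-Homology.Invariance_of_Domain"
    "HOL-Computational_Algebra.Fundamental_Theorem_Algebra"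
begin

no_notation fps_nth (infixl "$" 75)

text \<open>
  Let \<open>U\<close> be the interior of \<open>T\<close> and place the center at \<open>0\<close>. Since \<open>0 \<notin> U\<close>, the center lies in a
  neighbour \<open>T + z\<close> and by symmetry in \<open>T - z\<close>, so the tiles \<open>T + (2k+1)z\<close> form a connected unbounded set
  through \<open>0\<close> that misses \<open>U\<close>. Suppose \<open>U\<close> is simply connected. A path in \<open>U\<close> from some \<open>x\<close> to \<open>-x\<close>
  and its antipode form a loop that contracts within a compact symmetric \<open>K \<subseteq> U\<close>. As \<open>0\<close> can be moved
  to infinity outside \<open>K\<close>, the Hopf fibration pulled back to \<open>K\<close> by \<open>x \<mapsto> -x/\<bar>x\<bar>\<close> has a section
  \<open>y : K \<rightarrow> \<complex>\<^sup>2 - {0}\<close>. Then \<open>\<Phi>(x) = det (y(-x), y(x))\<close> is odd and without zeros, because the directions of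
  \<open>x\<close> and \<open>-x\<close> are antipodal. An odd function maps the loop to a curve with nonzero winding number,
  whereas contractibility forces the winding number \<open>0\<close>.

  For the twindragons, all differences of digit expansions exhaust the lattice, which makes the
  overlaps of distinct translates negligible; the point \<open>0\<close> and a nonzero lattice point in \<open>T\<close> are
  found as eventually periodic orbits of the expanding map, and they show that \<open>T\<close> is connected and
  that \<open>0\<close> is not interior.
\<close>

section \<open>Simply connected symmetric open sets\<close>

text \<open>
  \<open>spinor w a b\<close> says that \<open>(a, b)\<close> is an eigenvector, for the eigenvalue \<open>\<bar>w\<bar>\<close>, of the
  Pauli matrix \<open>\<sigma>(w) = w\<^sub>1\<sigma>\<^sub>1 + w\<^sub>2\<sigma>\<^sub>2 + w\<^sub>3\<sigma>\<^sub>3\<close>, i.e. lies over the direction of \<open>w\<close> in the Hopf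
  fibration. The functions \<open>spin1\<close> and \<open>spin2\<close> are the components of \<open>(\<bar>w\<bar> + \<sigma>(w)) (a, b)\<close>, an
  unnormalised projection to that eigenspace.
\<close>

definition spinor :: "real^3 \<Rightarrow> complex \<Rightarrow> complex \<Rightarrow> bool" where
  "spinor w a b \<longleftrightarrow>
     of_real (w$3) * a + Complex (w$1) (- w$2) * b = of_real (norm w) * a \<and>
     Complex (w$1) (w$2) * a - of_real (w$3) * b = of_real (norm w) * b"

definition spin1 :: "real^3 \<Rightarrow> complex \<Rightarrow> complex \<Rightarrow> complex" where
  "spin1 w a b = of_real (norm w) * a + (of_real (w$3) * a + Complex (w$1) (- w$2) * b)"

definition spin2 :: "real^3 \<Rightarrow> complex \<Rightarrow> complex \<Rightarrow> complex" where
  "spin2 w a b = of_real (norm w) * b + (Complex (w$1) (w$2) * a - of_real (w$3) * b)"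

lemma norm3_squared: "(norm (w::real^3))\<^sup>2 = (w$1)\<^sup>2 + (w$2)\<^sup>2 + (w$3)\<^sup>2"
  by (simp add: norm_vec_def L2_set_def sum_3 sum_nonneg)

text \<open>The Pauli identity sigma(w)^2 = |w|^2, componentwise on the vector
  \<open>(a, b)\<close>.\<close>

lemma sigma_squared:
  fixes w :: "real^3"
  shows "of_real (w$3) * (of_real (w$3) * a + Complex (w$1) (- w$2) * b)
          + Complex (w$1) (- w$2) * (Complex (w$1) (w$2) * a - of_real (w$3) * b)
          = of_real ((norm w)\<^sup>2) * a"
    and "Complex (w$1) (w$2) * (of_real (w$3) * a + Complex (w$1) (- w$2) * b)
          - of_real (w$3) * (Complex (w$1) (w$2) * a - of_real (w$3) * b)
          = of_real ((norm w)\<^sup>2) * b"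
  unfolding norm3_squared
  by (simp_all add: complex_eq_iff power2_eq_square algebra_simps)

text \<open>From sigma(w)^2 = |w|^2 follows sigma(w) (|w| + sigma(w)) = |w| (|w| + sigma(w)), so the
  projection lands in the eigenspace.\<close>

lemma spinor_spin: "spinor w (spin1 w a b) (spin2 w a b)"
  using sigma_squared[of w a b]
  unfolding spinor_def spin1_def spin2_def
  by (simp add: algebra_simps power2_eq_square)

lemma sigma_kernel:
  fixes n :: "real^3"
  assumes "of_real (n$3) * a + Complex (n$1) (- n$2) * b = 0"
    and "Complex (n$1) (n$2) * a - of_real (n$3) * b = 0"
    and "a \<noteq> 0 \<or> b \<noteq> 0"
  shows "n = 0"
proof -
  have "of_real ((norm n)\<^sup>2) * a = 0" "of_real ((norm n)\<^sup>2) * b = 0"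
    using sigma_squared[of n a b] assms(1,2) by auto
  then show ?thesis using assms(3) by auto
qed

text \<open>If the projection vanishes, \<open>(a, b)\<close> has eigenvalue -|w'| under sigma(w')
  and |w| under sigma(w). By linearity sigma(|w'| w + |w| w') annihilates it, and a nonzero sigma is
  injective.\<close>

lemma spin_nonzero:
  fixes w w' :: "real^3"
  assumes s: "spinor w a b" and nz: "a \<noteq> 0 \<or> b \<noteq> 0"
    and z: "spin1 w' a b = 0" "spin2 w' a b = 0"
  shows "norm w' *\<^sub>R w + norm w *\<^sub>R w' = 0"
proof (rule sigma_kernel[OF _ _ nz])
  let ?n = "norm w' *\<^sub>R w + norm w *\<^sub>R w'"
  have s1: "of_real (w$3) * a + Complex (w$1) (- w$2) * b = of_real (norm w) * a"
    and s2: "Complex (w$1) (w$2) * a - of_real (w$3) * b = of_real (norm w) * b"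
    using s by (auto simp: spinor_def)
  have z1: "of_real (w'$3) * a + Complex (w'$1) (- w'$2) * b = - of_real (norm w') * a"
    and z2: "Complex (w'$1) (w'$2) * a - of_real (w'$3) * b = - of_real (norm w') * b"
    using z by (auto simp: spin1_def spin2_def eq_neg_iff_add_eq_0 algebra_simps)
  have C: "Complex (?n$1) (?n$2) = of_real (norm w') * Complex (w$1) (w$2) + of_real (norm w) * Complex (w'$1) (w'$2)"
    "Complex (?n$1) (- ?n$2) = of_real (norm w') * Complex (w$1) (-w$2) + of_real (norm w) * Complex (w'$1) (-w'$2)"
    by (simp_all add: complex_eq_iff)
  have "of_real (?n$3) * a + Complex (?n$1) (- ?n$2) * b =
     of_real (norm w') * (of_real (w$3) * a + Complex (w$1) (- w$2) * b)
     + of_real (norm w) * (of_real (w'$3) * a + Complex (w'$1) (- w'$2) * b)"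
    unfolding C by (simp add: algebra_simps)
  also have "\<dots> = 0" unfolding s1 z1 by simp
  finally show "of_real (?n$3) * a + Complex (?n$1) (- ?n$2) * b = 0" .
  have "Complex (?n$1) (?n$2) * a - of_real (?n$3) * b =
     of_real (norm w') * (Complex (w$1) (w$2) * a - of_real (w$3) * b)
     + of_real (norm w) * (Complex (w'$1) (w'$2) * a - of_real (w'$3) * b)"
    unfolding C by (simp add: algebra_simps)
  also have "\<dots> = 0" unfolding s2 z2 by simp
  finally show "Complex (?n$1) (?n$2) * a - of_real (?n$3) * b = 0" .
qed

text \<open>A zero determinant makes the two vectors proportional, so one nonzero vector would have
  both eigenvalues |w| and -|w| under sigma(w).\<close>

lemma spinor_antipodal_det:
  fixes w :: "real^3"
  assumes "spinor w a b" "a \<noteq> 0 \<or> b \<noteq> 0" "spinor (- w) a' b'" "a' \<noteq> 0 \<or> b' \<noteq> 0" "w \<noteq> 0"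
  shows "a' * b - b' * a \<noteq> 0"
proof
  assume d: "a' * b - b' * a = 0"
  obtain k where k: "a' = k * a" "b' = k * b"
  proof (cases "a = 0")
    case True
    then show ?thesis using that[of "b'/b"] d assms(2) by auto
  next
    case False
    then show ?thesis using that[of "a'/a"] d by (auto simp: field_simps)
  qed
  then have k0: "k \<noteq> 0" using assms(4) by auto
  have m: "Complex (-x) y = - Complex x (-y)" for x y by (simp add: complex_eq_iff)
  have "k * (of_real (w$3) * a + Complex (w$1) (- w$2) * b) = k * (- of_real (norm w) * a)"
    "k * (Complex (w$1) (w$2) * a - of_real (w$3) * b) = k * (- of_real (norm w) * b)"
    using arg_cong[OF conjunct1[OF assms(3)[unfolded spinor_def k]], of uminus]
      arg_cong[OF conjunct2[OF assms(3)[unfolded spinor_def k]], of uminus]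
    by (simp_all add: m algebra_simps)
  then have "of_real (norm w) * a = - of_real (norm w) * a" "of_real (norm w) * b = - of_real (norm w) * b"
    using assms(1) k0 unfolding spinor_def by auto
  then show False using assms(2,5) by (auto simp: eq_neg_iff_add_eq_0 simp flip: mult_2)
qed

text \<open>Projecting \<open>(1, 0)\<close> fails only for \<open>w\<close> on the closed negative
  third axis, where \<open>(0, 1)\<close> is an eigenvector.\<close>

lemma spinor_exists: obtains a b where "spinor w a b" "a \<noteq> 0 \<or> b \<noteq> 0"
proof (cases "spin1 w 1 0 = 0 \<and> spin2 w 1 0 = 0")
  case False
  then show ?thesis using that spinor_spin by blast
next
  case True
  then have "w$3 = - norm w" "w$1 = 0" "w$2 = 0"
    by (auto simp: spin1_def spin2_def complex_eq_iff)
  then have "spinor w 0 1" by (auto simp: spinor_def complex_eq_iff)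
  then show ?thesis using that by auto
qed

section \<open>Sections of the pulled-back Hopf fibration\<close>

text \<open>For \<open>w\<close> outside \<open>K\<close> this is a nowhere zero lift through the
  Hopf fibration of the direction map from points of \<open>K\<close> to \<open>w\<close>; the base
  point \<open>w\<close> is a parameter so that it can be moved.\<close>

definition spinor_field :: "(real^3) set \<Rightarrow> real^3 \<Rightarrow> (real^3 \<Rightarrow> complex) \<Rightarrow> (real^3 \<Rightarrow> complex) \<Rightarrow> bool" where
  "spinor_field K w f g \<longleftrightarrow> continuous_on K f \<and> continuous_on K g \<and>
     (\<forall>x\<in>K. spinor (w - x) (f x) (g x) \<and> (f x \<noteq> 0 \<or> g x \<noteq> 0))"

lemma continuous_on_spin:
  assumes "continuous_on K f" "continuous_on K g"
  shows "continuous_on K (\<lambda>x. spin1 (w - x) (f x) (g x))"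
    "continuous_on K (\<lambda>x. spin2 (w - x) (f x) (g x))"
  unfolding spin1_def spin2_def Complex_eq
  by (intro continuous_intros assms)+

text \<open>
  Projecting the spinor over \<open>w - x\<close> to the eigenspace of \<open>w' - x\<close> gives \<open>0\<close> only if these directions
  are antipodal, i.e. if \<open>x\<close> lies between \<open>w\<close> and \<open>w'\<close>.
\<close>

lemma spinor_field_move:
  assumes F: "spinor_field K w f g" and seg: "closed_segment w w' \<inter> K = {}"
  shows "\<exists>f g. spinor_field K w' f g"
proof -
  let ?f = "\<lambda>x. spin1 (w' - x) (f x) (g x)"
  let ?g = "\<lambda>x. spin2 (w' - x) (f x) (g x)"
  have "?f x \<noteq> 0 \<or> ?g x \<noteq> 0" if x: "x \<in> K" for x
  proof (rule ccontr)
    assume "\<not> ?thesis"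
    then have eq: "norm (w' - x) *\<^sub>R (w - x) + norm (w - x) *\<^sub>R (w' - x) = 0"
      using spin_nonzero[of "w - x" "f x" "g x" "w' - x"] F x by (auto simp: spinor_field_def)
    \<comment> \<open>Dividing \<open>eq\<close> by \<open>s\<close> exhibits \<open>x\<close> as a
      convex combination of \<open>w\<close> and \<open>w'\<close>.\<close>
    define s where "s = norm (w' - x) + norm (w - x)"
    have "w \<noteq> x" "w' \<noteq> x" using seg x by auto
    then have s0: "s > 0" by (simp add: s_def add_pos_pos)
    have "s *\<^sub>R x = norm (w' - x) *\<^sub>R w + norm (w - x) *\<^sub>R w'"
      using eq by (simp add: s_def algebra_simps)
    then have "inverse s *\<^sub>R s *\<^sub>R x = inverse s *\<^sub>R (norm (w' - x) *\<^sub>R w + norm (w - x) *\<^sub>R w')"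
      by simp
    then have "x = (norm (w' - x) / s) *\<^sub>R w + (norm (w - x) / s) *\<^sub>R w'"
      using s0 by (simp add: scaleR_add_right divide_inverse_commute)
    moreover have "norm (w' - x) / s = 1 - norm (w - x) / s"
      using s0 by (simp add: s_def field_simps)
    ultimately have "x = (1 - norm (w - x) / s) *\<^sub>R w + (norm (w - x) / s) *\<^sub>R w'"
      by simp
    moreover have "0 \<le> norm (w - x) / s" "norm (w - x) / s \<le> 1"
      using s0 by (auto simp: s_def)
    ultimately have "x \<in> closed_segment w w'" unfolding closed_segment_def by blast
    then show False using seg x by auto
  qed
  then have "spinor_field K w' ?f ?g"
    using F unfolding spinor_field_def by (auto intro: continuous_on_spin spinor_spin)
  then show ?thesis by blast
qed

text \<open>Seen from points of a ball around 0 of radius |v|, the direction to \<open>v\<close> is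
  never opposite to \<open>v\<close>, so one constant spinor over \<open>v\<close> can be projected
  everywhere.\<close>

lemma spinor_field_far:
  assumes K: "K \<subseteq> ball 0 (norm v)"
  shows "\<exists>f g. spinor_field K v f g"
proof -
  obtain a b where ab: "spinor v a b" "a \<noteq> 0 \<or> b \<noteq> 0" using spinor_exists by blast
  let ?f = "\<lambda>x. spin1 (v - x) a b"
  let ?g = "\<lambda>x. spin2 (v - x) a b"
  have "?f x \<noteq> 0 \<or> ?g x \<noteq> 0" if x: "x \<in> K" for x
  proof (rule ccontr)
    assume "\<not> ?thesis"
    then have eq: "norm (v - x) *\<^sub>R v + norm v *\<^sub>R (v - x) = 0"
      using spin_nonzero[OF ab] by auto
    have xv: "norm x < norm v" using K x by auto
    have "norm v *\<^sub>R x = (norm (v - x) + norm v) *\<^sub>R v"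
      using eq by (simp add: algebra_simps)
    then have "norm (norm v *\<^sub>R x) = norm ((norm (v - x) + norm v) *\<^sub>R v)" by simp
    then have "norm v * norm x = (norm (v - x) + norm v) * norm v" by simp
    moreover have "norm v > 0" using xv by (meson norm_ge_zero le_less_trans)
    ultimately have "norm x = norm (v - x) + norm v" by simp
    then show False using xv by (smt (verit) norm_ge_zero)
  qed
  then have "spinor_field K v ?f ?g"
    unfolding spinor_field_def by (auto intro: continuous_on_spin spinor_spin)
  then show ?thesis by blast
qed

text \<open>Fields exist for a far point of \<open>S\<close>. Points of \<open>S\<close> in a small
  ball off \<open>K\<close> are joined by segments avoiding \<open>K\<close>, so existence
  propagates along the connected set \<open>S\<close>.\<close>

lemma spinor_field_unbounded:
  assumes K: "compact K" and S: "connected S" "\<not> bounded S" "S \<inter> K = {}" and w: "w \<in> S"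
  shows "\<exists>f g. spinor_field K w f g"
proof -
  obtain B where B: "\<And>x. x \<in> K \<Longrightarrow> norm x \<le> B" 
    using compact_imp_bounded[OF K] by (auto simp: bounded_iff)
  obtain v where v: "v \<in> S" "norm v > B" using S(2) by (meson bounded_iff not_le)
  show ?thesis
  proof (rule connected_induction_simple[OF S(1) v(1) w])
    show "\<exists>f g. spinor_field K v f g"
      by (rule spinor_field_far) (use B v in force)
    fix a assume "a \<in> S"
    then have "a \<in> - K" "open (- K)" using S(3) K compact_imp_closed by auto
    then obtain e where e: "e > 0" "ball a e \<subseteq> - K" using open_contains_ball by blast
    show "\<exists>T. openin (top_of_set S) T \<and> a \<in> T \<and>
       (\<forall>x\<in>T. \<forall>y\<in>T. (\<exists>f g. spinor_field K x f g) \<longrightarrow> (\<exists>f g. spinor_field K y f g))"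
    proof (intro exI[of _ "S \<inter> ball a e"] conjI ballI impI)
      show "openin (top_of_set S) (S \<inter> ball a e)" by auto
      show "a \<in> S \<inter> ball a e" using \<open>a \<in> S\<close> e by auto
      fix x y assume x: "\<exists>f g. spinor_field K x f g" and "x \<in> S \<inter> ball a e" "y \<in> S \<inter> ball a e"
      then have "closed_segment x y \<subseteq> ball a e" by (intro closed_segment_subset convex_ball) auto
      then have "closed_segment x y \<inter> K = {}" using e by auto
      then show "\<exists>f g. spinor_field K y f g"
        using x spinor_field_move by blast
    qed
  qed
qed

section \<open>Odd loops and the contradiction to simple connectedness\<close>

text \<open>For a continuous logarithm \<open>l\<close>, the half-period increment \<open>d\<close>
  takes values in the odd multiples of pi i, hence is constant. Winding number 0 would give d(0) +
  d(1/2) = 0, so d(0) = 0, although exp(d(0)) = -1.\<close>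

lemma antiperiodic_loop_winding_nonzero:
  fixes q :: "real \<Rightarrow> complex"
  assumes q: "path q" "0 \<notin> path_image q"
    and anti: "\<And>t. t \<in> {0..1/2} \<Longrightarrow> q (t + 1/2) = - q t"
  shows "winding_number q 0 \<noteq> 0"
proof
  assume 0: "winding_number q 0 = 0"
  obtain l where l: "path l" "pathfinish l - pathstart l = 2 * of_real pi * \<i> * winding_number q 0"
    "\<And>t. t \<in> {0..1} \<Longrightarrow> q t = 0 + exp (l t)"
    using winding_number_as_continuous_log[OF q] by blast
  define d where "d t = l (t + 1/2) - l t" for t
  have ed: "exp (d t) = -1" if "t \<in> {0..1/2}" for t
  proof -
    have "exp (l (t + 1/2)) = - exp (l t)" using anti[OF that] l(3)[of t] l(3)[of "t+1/2"] that by auto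
    then show ?thesis by (simp add: d_def exp_diff)
  qed
  have "continuous_on {0..1} l" using l(1) by (simp add: path_def)
  then have "continuous_on {0..1/2} (\<lambda>t. l (t + 1/2))" "continuous_on {0..1/2} l"
    by (auto intro!: continuous_on_compose2[of "{0..1}" l] continuous_intros intro: continuous_on_subset)
  then have cd: "continuous_on {0..1/2} d" unfolding d_def by (rule continuous_on_diff)
  have "d constant_on {0..1/2}"
  proof (rule continuous_discrete_range_constant[OF _ cd])
    fix x assume x: "x \<in> {0..1/2::real}"
    \<comment> \<open>Distinct logarithms of -1 are at least \<open>2*pi\<close> apart, so the range
      of \<open>d\<close> is discrete.\<close>
    show "\<exists>e>0. \<forall>y. y \<in> {0..1/2} \<and> d y \<noteq> d x \<longrightarrow> e \<le> norm (d y - d x)"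
    proof (intro exI[of _ "2*pi"] conjI allI impI)
      fix y assume y: "y \<in> {0..1/2} \<and> d y \<noteq> d x"
      then have "exp (d y) = exp (d x)" using ed x by auto
      then obtain n::int where n: "d y = d x + of_int (2 * n) * pi * \<i>" by (auto simp: exp_eq)
      then have "n \<noteq> 0" using y by auto
      then have "\<bar>n\<bar> \<ge> 1" by auto
      then have "\<bar>real_of_int n\<bar> \<ge> 1" by linarith
      moreover have "norm (d y - d x) = 2 * pi * \<bar>real_of_int n\<bar>" by (simp add: n norm_mult)
      ultimately show "2 * pi \<le> norm (d y - d x)" by simp
    qed auto
  qed auto
  then have "d 0 = d (1/2)" unfolding constant_on_def by auto
  moreover have "l 1 = l 0" using l(2) 0 by (simp add: pathstart_def pathfinish_def)
  ultimately have "d 0 = 0" by (simp add: d_def)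
  then show False using ed[of 0] by auto
qed

text \<open>\<open>S\<close> is the route along which the base point \<open>0\<close> escapes to
  infinity without meeting \<open>U\<close>.\<close>

lemma symmetric_not_simply_connected:
  fixes U :: "(real^3) set"
  assumes U: "open U" "U \<noteq> {}" and sym: "uminus ` U \<subseteq> U"
    and S: "connected S" "\<not> bounded S" "S \<inter> U = {}" "0 \<in> S"
  shows "\<not> simply_connected U"
proof
  assume sc: "simply_connected U"
  obtain x0 where x0: "x0 \<in> U" using U by auto
  have "- x0 \<in> U" using sym x0 by auto
  moreover have "path_connected U" using sc by (rule simply_connected_imp_path_connected)
  ultimately obtain p where p: "path p" "path_image p \<subseteq> U" "pathstart p = x0" "pathfinish p = - x0"
    using x0 unfolding path_connected_def by blast
  define q where "q = p +++ (uminus \<circ> p)"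
  have mp: "path (uminus \<circ> p)" by (intro path_continuous_image p continuous_intros)
  have q: "path q" "path_image q \<subseteq> U" "pathstart q = x0" "pathfinish q = x0"
    using p mp sym unfolding q_def 
    by (auto simp: path_image_compose path_image_join pathstart_compose pathfinish_compose)
  then have "homotopic_loops U q (linepath x0 x0)"
    using sc x0 unfolding simply_connected_def by auto
  then obtain h where h: "continuous_on ({0..1} \<times> {0..1}) h" "h \<in> ({0..1::real} \<times> {0..1::real}) \<rightarrow> U"
    "\<forall>x\<in>{0..1}. h (0, x) = q x" "\<forall>x\<in>{0..1}. h (1, x) = linepath x0 x0 x"
    "\<forall>t\<in>{0..1}. pathfinish (h \<circ> Pair t) = pathstart (h \<circ> Pair t)"
    unfolding homotopic_loops by (auto simp: image_subset_iff_funcset)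
  \<comment> \<open>The image of the homotopy supplies the compactness needed to start from a far
    base point; adding its antipode lets \<open>\<Phi>\<close> be evaluated at both \<open>x\<close>
    and \<open>-x\<close>.\<close>
  define K0 where "K0 = h ` ({0..1} \<times> {0..1})"
  have K0: "compact K0" "K0 \<subseteq> U"
    using h by (auto simp: K0_def intro!: compact_continuous_image compact_Times)
  have hom0: "homotopic_loops K0 q (linepath x0 x0)"
    unfolding homotopic_loops using h by (intro exI[of _ h]) (auto simp: K0_def)
  define K where "K = K0 \<union> uminus ` K0"
  have K: "compact K" "K \<subseteq> U"
    using K0 sym by (auto simp: K_def intro!: compact_Un compact_negations)
  have symK: "- x \<in> K" if "x \<in> K" for x using that by (auto simp: K_def)
  have hom: "homotopic_loops K q (linepath x0 x0)"
    by (rule homotopic_loops_subset[OF hom0]) (auto simp: K_def)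
  have "S \<inter> K = {}" using S K by auto
  then obtain f g where fg: "spinor_field K 0 f g" 
    using spinor_field_unbounded[OF K(1) S(1,2) _ S(4)] by blast
  \<comment> \<open>The determinant of the spinors over \<open>x\<close> and \<open>-x\<close> is an odd nonvanishing function on \<open>K\<close>.\<close>
  define \<Phi> where "\<Phi> x = f (- x) * g x - g (- x) * f x" for x
  have odd: "\<Phi> (- x) = - \<Phi> x" for x by (simp add: \<Phi>_def)
  have cf: "continuous_on K f" "continuous_on K g" using fg by (auto simp: spinor_field_def)
  have "continuous_on K (\<lambda>x. f (- x))" "continuous_on K (\<lambda>x. g (- x))"
    by (intro continuous_on_compose2[OF cf(1)] continuous_on_compose2[OF cf(2)] continuous_intros; use symK in auto)+
  then have c\<Phi>: "continuous_on K \<Phi>" unfolding \<Phi>_def by (intro continuous_intros cf)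
  have nz: "\<Phi> x \<noteq> 0" if x: "x \<in> K" for x
  proof -
    have "x \<noteq> 0" using x K S by auto
    then show ?thesis unfolding \<Phi>_def
      using spinor_antipodal_det[of "- x" "f x" "g x" "f (- x)" "g (- x)"] fg x symK[OF x]
      by (auto simp: spinor_field_def)
  qed
  have "homotopic_loops (- {0}) (\<Phi> \<circ> q) (\<Phi> \<circ> linepath x0 x0)"
    by (rule homotopic_loops_continuous_image[OF hom c\<Phi>]) (use nz in auto)
  then have "winding_number (\<Phi> \<circ> q) 0 = winding_number (\<Phi> \<circ> linepath x0 x0) 0"
    by (rule winding_number_homotopic_loops)
  also have "\<Phi> \<circ> linepath x0 x0 = linepath (\<Phi> x0) (\<Phi> x0)"
    by (auto simp: linepath_def algebra_simps simp flip: scaleR_left_distrib)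
  also have "x0 \<in> K" using hom homotopic_loops_imp_subset by fastforce
  then have "winding_number (linepath (\<Phi> x0) (\<Phi> x0)) 0 = 0" using nz by force
  finally have w0: "winding_number (\<Phi> \<circ> q) 0 = 0" .
  have qK: "path_image q \<subseteq> K" using hom homotopic_loops_imp_subset by blast
  have "winding_number (\<Phi> \<circ> q) 0 \<noteq> 0"
  proof (rule antiperiodic_loop_winding_nonzero)
    show "path (\<Phi> \<circ> q)" using q qK c\<Phi> by (meson continuous_on_subset path_continuous_image)
    show "0 \<notin> path_image (\<Phi> \<circ> q)" using qK nz by (auto simp: path_image_compose)
    fix t :: real assume t: "t \<in> {0..1/2}"
    have "q (t + 1/2) = - q t"
    proof (cases "t = 0")
      case True
      then show ?thesis using p by (simp add: q_def joinpaths_def pathstart_def pathfinish_def)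
    next
      case False
      then show ?thesis using t by (simp add: q_def joinpaths_def algebra_simps)
    qed
    then show "(\<Phi> \<circ> q) (t + 1/2) = - (\<Phi> \<circ> q) t" using odd by simp
  qed
  then show False using w0 by simp
qed

section \<open>Self-affine lattice tiles\<close>

text \<open>Solved for the later term, the recursion contracts by r = 1/|l| up to a null
  perturbation.\<close>

lemma backward_shift_tendsto_0:
  fixes v :: "nat \<Rightarrow> complex"
  assumes l: "norm l > 1" and w: "(\<lambda>n. v n - l * v (Suc n)) \<longlonglongrightarrow> 0"
  shows "v \<longlonglongrightarrow> 0"
proof (rule LIMSEQ_I)
  fix e :: real assume e: "e > 0"
  define r where "r = inverse (norm l)"
  have r: "0 < r" "r < 1" using l by (auto simp: r_def inverse_less_1_iff)
  \<comment> \<open>This tolerance makes \<open>e/2\<close> the fixed point of the bound u -> r u +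
    e/2 (1 - r) in \<open>step\<close>.\<close>
  have "e/2 * (1 - r) / r > 0" using e r by simp
  then obtain N where N: "\<And>n. n \<ge> N \<Longrightarrow> norm (v n - l * v (Suc n)) < e/2 * (1 - r) / r"
    using LIMSEQ_D[OF w] by auto
  have step: "norm (v (Suc n)) \<le> r * norm (v n) + e/2 * (1 - r)" if "n \<ge> N" for n
  proof -
    have "norm l * norm (v (Suc n)) \<le> norm (v n) + norm (v n - l * v (Suc n))"
      by (metis norm_mult norm_triangle_sub norm_minus_commute)
    also have "\<dots> \<le> norm (v n) + e/2 * (1 - r) / r" using N[OF that] by simp
    finally have "r * (norm l * norm (v (Suc n))) \<le> r * (norm (v n) + e/2 * (1 - r) / r)"
      using r by (intro mult_left_mono) auto
    moreover have "r * (norm l * norm (v (Suc n))) = norm (v (Suc n))"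
      using l by (auto simp: r_def field_simps)
    moreover have "r * (norm (v n) + e/2 * (1 - r) / r) = r * norm (v n) + e/2 * (1 - r)"
      using r by (simp add: field_simps)
    ultimately show ?thesis by simp
  qed
  have bound: "norm (v (N + k)) \<le> e/2 + r ^ k * norm (v N)" for k
  proof (induction k)
    case (Suc k)
    have "norm (v (N + Suc k)) \<le> r * norm (v (N + k)) + e/2 * (1 - r)"
      using step[of "N + k"] by simp
    also have "\<dots> \<le> r * (e/2 + r ^ k * norm (v N)) + e/2 * (1 - r)"
      using Suc r by (intro add_right_mono mult_left_mono) auto
    also have "\<dots> = e/2 + r ^ Suc k * norm (v N)" by (simp add: field_simps)
    finally show ?case .
  qed (use e in simp)
  have "(\<lambda>k. r ^ k * norm (v N)) \<longlonglongrightarrow> 0"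
    using r by (intro tendsto_mult_left_zero LIMSEQ_power_zero) auto
  then obtain k0 where k0: "\<And>k. k \<ge> k0 \<Longrightarrow> r ^ k * norm (v N) < e/2"
    using LIMSEQ_D[of _ 0 "e/2"] e r by (fastforce simp: abs_mult)
  show "\<exists>no. \<forall>n\<ge>no. norm (v n - 0) < e"
  proof (intro exI[of _ "N + k0"] allI impI)
    fix n assume "n \<ge> N + k0"
    then have "n = N + (n - N)" "n - N \<ge> k0" by auto
    then show "norm (v n - 0) < e" using bound[of "n - N"] k0[of "n - N"] by (simp add: le_add_diff_inverse)
  qed
qed

text \<open>Here \<open>t\<close> is the trace and \<open>s\<close> the sum of the principal 2x2
  minors, the coefficients of the characteristic polynomial.\<close>

lemma Cayley_Hamilton_3:
  fixes M :: "real^3^3" and x :: "real^3"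
  defines "t \<equiv> M$1$1 + M$2$2 + M$3$3"
    and "s \<equiv> M$1$1 * M$2$2 - M$1$2 * M$2$1 + M$1$1 * M$3$3 - M$1$3 * M$3$1 + M$2$2 * M$3$3 - M$2$3 * M$3$2"
  shows "M *v (M *v (M *v x)) - t *\<^sub>R (M *v (M *v x)) + s *\<^sub>R (M *v x) - det M *\<^sub>R x = 0"
  unfolding t_def s_def
  by (simp add: vec_eq_iff forall_3 matrix_vector_mult_def sum_3 det_3 algebra_simps)

lemma det_mat_minus_3:
  fixes M :: "real^3^3" and z :: complex
  defines "t \<equiv> M$1$1 + M$2$2 + M$3$3"
    and "s \<equiv> M$1$1 * M$2$2 - M$1$2 * M$2$1 + M$1$1 * M$3$3 - M$1$3 * M$3$1 + M$2$2 * M$3$3 - M$2$3 * M$3$2"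
  shows "det (mat z - (\<chi> i j. complex_of_real (M $ i $ j))) = z^3 - of_real t * z^2 + of_real s * z - of_real (det M)"
  unfolding t_def s_def
  by (simp add: det_3 mat_def algebra_simps power2_eq_square power3_eq_cube)

lemma cubic_factors:
  fixes t s d :: complex
  obtains l1 l2 l3 where "t = l1 + l2 + l3" "s = l1 * l2 + l1 * l3 + l2 * l3" "d = l1 * l2 * l3"
proof -
  have "\<exists>l1. poly [:-d, s, -t, 1:] l1 = 0"
    using fundamental_theorem_of_algebra_alt[of "[:-d, s, -t, 1:]"] by (auto simp: pCons_eq_iff)
  then obtain l1 where l1: "l1^3 - t * l1^2 + s * l1 - d = 0"
    by (auto simp: power2_eq_square power3_eq_cube algebra_simps)
  \<comment> \<open>This quadratic is the quotient of the cubic by the linear factor of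
    \<open>l1\<close>.\<close>
  have "\<exists>l2. poly [:s - t * l1 + l1\<^sup>2, l1 - t, 1:] l2 = 0"
    using fundamental_theorem_of_algebra_alt[of "[:s - t * l1 + l1\<^sup>2, l1 - t, 1:]"] by (auto simp: pCons_eq_iff)
  then obtain l2 where l2: "l2^2 + (l1 - t) * l2 + (s - t * l1 + l1\<^sup>2) = 0"
    by (auto simp: power2_eq_square power3_eq_cube algebra_simps)
  define l3 where "l3 = t - l1 - l2"
  have t: "t = l1 + l2 + l3" by (simp add: l3_def)
  have "s - (l1 * l2 + l1 * l3 + l2 * l3) = l2^2 + (l1 - t) * l2 + (s - t * l1 + l1\<^sup>2)"
    unfolding t by (simp add: algebra_simps power2_eq_square)
  then have s: "s = l1 * l2 + l1 * l3 + l2 * l3" using l2 by simp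
  have "l1 * l2 * l3 - d = l1^3 - t * l1^2 + s * l1 - d"
    unfolding s t by (simp add: algebra_simps power2_eq_square power3_eq_cube)
  then have "d = l1 * l2 * l3" using l1 by simp
  then show ?thesis using that t s by blast
qed

lemma linear_funpow:
  fixes L :: "'a::real_vector \<Rightarrow> 'a"
  assumes "linear L"
  shows "linear (L ^^ n)"
proof (induction n)
  case 0
  show ?case using linear_id by (simp add: id_def)
next
  case (Suc n)
  then show ?case using linear_compose[OF Suc assms] by (simp add: o_def)
qed

lemma matrix_inv_mul_vector:
  fixes M :: "real^'n^'n"
  assumes "invertible M"
  shows "M *v (matrix_inv M *v x) = x" "matrix_inv M *v (M *v x) = x"
proof -
  have "M ** matrix_inv M = mat 1 \<and> matrix_inv M ** M = mat 1"
    unfolding matrix_inv_def using assms[unfolded invertible_def] by (rule someI_ex)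
  then show "M *v (matrix_inv M *v x) = x" "matrix_inv M *v (M *v x) = x"
    by (simp_all add: matrix_vector_mul_assoc)
qed

text \<open>By Cayley-Hamilton each coordinate of the backward iterates satisfies a linear
  recurrence, which splits into three backward shifts by the eigenvalues. Undoing them one at a time
  gives convergence to 0; the basis vectors make it uniform.\<close>

lemma expanding_imp_contraction:
  assumes M: "expanding M"
  shows expanding_imp_invertible: "invertible M"
    and "e > 0 \<Longrightarrow> \<exists>n. \<forall>x. norm (((*v) (matrix_inv M) ^^ n) x) \<le> e * norm x"
proof -
  define t where "t = M$1$1 + M$2$2 + M$3$3"
  define s where "s = M$1$1 * M$2$2 - M$1$2 * M$2$1 + M$1$1 * M$3$3 - M$1$3 * M$3$1 + M$2$2 * M$3$3 - M$2$3 * M$3$2"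
  note char = det_mat_minus_3[of _ M, folded t_def s_def]
  show inv: "invertible M"
    unfolding invertible_det_nz
  proof
    assume "det M = 0"
    then have "det (mat 0 - (\<chi> i j. complex_of_real (M $ i $ j))) = 0" using char[of 0] by simp
    then have "1 < cmod 0" using M unfolding expanding_def by blast
    then show False by simp
  qed
  obtain l1 l2 l3 where st: "complex_of_real t = l1 + l2 + l3" "complex_of_real s = l1 * l2 + l1 * l3 + l2 * l3"
    and d: "complex_of_real (det M) = l1 * l2 * l3"
    using cubic_factors[of "complex_of_real t" "of_real s" "of_real (det M)"] by blast
  have fac: "z^3 - of_real t * z^2 + of_real s * z - of_real (det M) = (z - l1) * (z - l2) * (z - l3)" for z
    unfolding st d by (simp add: algebra_simps power2_eq_square power3_eq_cube)
  have root: "norm z > 1" if "z \<in> {l1, l2, l3}" for z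
  proof -
    have "det (mat z - (\<chi> i j. complex_of_real (M $ i $ j))) = 0"
      unfolding char fac using that by auto
    then show ?thesis using M unfolding expanding_def by blast
  qed
  let ?L = "(*v) (matrix_inv M)"
  have inv_right: "M *v (?L x) = x" for x
    using inv by (rule matrix_inv_mul_vector)
  have lim: "(\<lambda>n. (?L ^^ n) x $ i) \<longlonglongrightarrow> 0" for x i
  proof -
    define u where "u n = complex_of_real ((?L ^^ n) x $ i)" for n
    define a where "a n = u n - l1 * u (Suc n)" for n
    define b where "b n = a n - l2 * a (Suc n)" for n
    have rec: "u n - of_real t * u (Suc n) + of_real s * u (Suc (Suc n)) - of_real (det M) * u (Suc (Suc (Suc n))) = 0" for n
    proof -
      define y where "y = (?L ^^ n) x"
      have "M *v (M *v (M *v ?L (?L (?L y)))) - t *\<^sub>R (M *v (M *v ?L (?L (?L y)))) + s *\<^sub>R (M *v ?L (?L (?L y))) - det M *\<^sub>R ?L (?L (?L y)) = 0"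
        unfolding t_def s_def by (rule Cayley_Hamilton_3)
      then have "(y - t *\<^sub>R ?L y + s *\<^sub>R ?L (?L y) - det M *\<^sub>R ?L (?L (?L y))) $ i = 0" by (simp add: inv_right)
      then have "of_real ((y - t *\<^sub>R ?L y + s *\<^sub>R ?L (?L y) - det M *\<^sub>R ?L (?L (?L y))) $ i) = (0::complex)" by simp
      then show ?thesis by (simp add: u_def y_def)
    qed
    \<comment> \<open>With E the index shift, \<open>rec\<close> reads (1 - l1 E)(1 - l2 E)(1 - l3
      E) u = 0.\<close>
    have "b n - l3 * b (Suc n) = 0" for n
      unfolding rec[of n, symmetric] b_def a_def st d by (simp add: algebra_simps)
    then have "(\<lambda>n. b n - l3 * b (Suc n)) \<longlonglongrightarrow> 0" by (simp only: tendsto_const)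
    then have "b \<longlonglongrightarrow> 0" by (rule backward_shift_tendsto_0[rotated]) (use root in simp)
    then have "a \<longlonglongrightarrow> 0" unfolding b_def by (rule backward_shift_tendsto_0[rotated]) (use root in simp)
    then have "u \<longlonglongrightarrow> 0" unfolding a_def by (rule backward_shift_tendsto_0[rotated]) (use root in simp)
    then show ?thesis unfolding u_def by (metis of_real_0 tendsto_of_real_iff)
  qed
  have lin: "linear (?L ^^ n)" for n
    by (intro linear_funpow matrix_vector_mul_linear)
  show "\<exists>n. \<forall>x. norm ((?L ^^ n) x) \<le> e * norm x" if e: "e > 0"
  proof -
    have "(\<lambda>n. \<Sum>j\<in>UNIV. \<Sum>i\<in>UNIV. \<bar>(?L ^^ n) (axis j 1) $ i\<bar>) \<longlonglongrightarrow> 0"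
      by (intro tendsto_null_sum tendsto_rabs_zero lim)
    then obtain n where "norm ((\<Sum>j\<in>UNIV. \<Sum>i\<in>UNIV. \<bar>(?L ^^ n) (axis j 1) $ i\<bar>) - 0) < e"
      using LIMSEQ_D[OF _ e] by blast
    then have n: "(\<Sum>j\<in>UNIV. \<Sum>i\<in>UNIV. \<bar>(?L ^^ n) (axis j 1) $ i\<bar>) \<le> e" by simp
    have "norm ((?L ^^ n) x) \<le> e * norm x" for x
    proof -
      have "x = (\<Sum>j\<in>UNIV. x $ j *\<^sub>R axis j 1)"
        using basis_expansion[of x] by (simp add: scalar_mult_eq_scaleR)
      then have "(?L ^^ n) x = (?L ^^ n) (\<Sum>j\<in>UNIV. x $ j *\<^sub>R axis j 1)" by simp
      also have "\<dots> = (\<Sum>j\<in>UNIV. x $ j *\<^sub>R (?L ^^ n) (axis j 1))"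
        by (simp add: linear_sum[OF lin] linear_scale[OF lin])
      finally have "norm ((?L ^^ n) x) \<le> (\<Sum>j\<in>UNIV. norm (x $ j *\<^sub>R (?L ^^ n) (axis j 1)))"
        by (simp add: sum_norm_le)
      also have "\<dots> \<le> (\<Sum>j\<in>UNIV. norm x * (\<Sum>i\<in>UNIV. \<bar>(?L ^^ n) (axis j 1) $ i\<bar>))"
        by (intro sum_mono) (simp add: mult_mono component_le_norm_cart norm_le_l1_cart)
      also have "\<dots> \<le> norm x * e" unfolding sum_distrib_left[symmetric] using n by (intro mult_left_mono) auto
      finally show ?thesis by (simp add: mult.commute)
    qed
    then show ?thesis by blast
  qed
qed


section \<open>The integer lattice and coverings by its translates\<close>

lemma subset_Zlat_closed:
  assumes "A \<subseteq> Zlat"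
  shows "closed A"
proof (rule discrete_imp_closed[of 1])
  show "\<forall>x\<in>A. \<forall>y\<in>A. dist y x < 1 \<longrightarrow> y = x"
  proof (intro ballI impI)
    fix x y assume "x \<in> A" "y \<in> A" and d: "dist y x < 1"
    then have Z: "x \<in> Zlat" "y \<in> Zlat" using assms by auto
    have "y $ i = x $ i" for i
    proof -
      have "y $ i \<in> \<int>" "x $ i \<in> \<int>" using Z by (auto simp: Zlat_def)
      moreover have "\<bar>y $ i - x $ i\<bar> < 1"
        using d component_le_norm_cart[of "y - x" i] by (simp add: dist_norm)
      ultimately show ?thesis by (metis Ints_eq_abs_less1)
    qed
    then show "y = x" by (simp add: vec_eq_iff)
  qed
qed simp

lemma Zlat_minus: "x \<in> Zlat \<Longrightarrow> - x \<in> Zlat"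
  and Zlat_diff: "x \<in> Zlat \<Longrightarrow> y \<in> Zlat \<Longrightarrow> x - y \<in> Zlat"
  and Zlat_zero: "0 \<in> Zlat"
  by (auto simp: Zlat_def)

lemma Zlat_scale: "x \<in> Zlat \<Longrightarrow> k \<in> \<int> \<Longrightarrow> k *\<^sub>R x \<in> Zlat"
  by (auto simp: Zlat_def)

lemma countable_Zlat: "countable Zlat"
proof -
  have "Zlat \<subseteq> range (\<lambda>(a, b, c). vector [real_of_int a, real_of_int b, real_of_int c])"
  proof
    fix x :: "real^3" assume "x \<in> Zlat"
    then obtain f :: "3 \<Rightarrow> int" where "\<And>i. x $ i = of_int (f i)"
      unfolding Zlat_def Ints_def by (auto simp: image_iff) metis
    then have "x = (\<lambda>(a, b, c). vector [real_of_int a, real_of_int b, real_of_int c]) (f 1, f 2, f 3)"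
      by (simp add: vec_eq_iff forall_3 vector_3)
    then show "x \<in> range (\<lambda>(a, b, c). vector [real_of_int a, real_of_int b, real_of_int c])" by blast
  qed
  then show ?thesis by (rule countable_subset) auto
qed

lemma closed_lattice_translates:
  assumes "compact T" "A \<subseteq> Zlat"
  shows "closed (\<Union>z\<in>A. (\<lambda>x. x + z) ` T)"
proof -
  have "(\<Union>z\<in>A. (\<lambda>x. x + z) ` T) = (\<Union>x\<in>T. \<Union>y\<in>A. {x + y})" by auto
  then show ?thesis
    using compact_closed_sums[OF assms(1) subset_Zlat_closed[OF assms(2)]] by simp
qed

text \<open>Otherwise the complements of the countably many translates would be open and dense, and
  by Baire their intersection would be dense; but covering makes it empty.\<close>

lemma lattice_cover_interior_nonempty:
  assumes T: "compact T" and cover: "(\<Union>z\<in>Zlat. (\<lambda>x. x + z) ` T) = UNIV"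
  shows "interior T \<noteq> {}"
proof
  assume empty: "interior T = {}"
  let ?G = "(\<lambda>z. - ((\<lambda>x. z + x) ` T)) ` Zlat"
  have "UNIV \<subseteq> closure (\<Inter>?G)"
  proof (rule Baire)
    fix A assume "A \<in> ?G"
    then obtain z where A: "A = - ((\<lambda>x. z + x) ` T)" by auto
    have "interior ((\<lambda>x. z + x) ` T) = {}" using empty by (simp add: interior_translation)
    then have "closure A = UNIV" by (simp add: A closure_complement)
    moreover have "open A" using T by (simp add: A open_Compl compact_imp_closed compact_translation)
    ultimately show "openin (top_of_set UNIV) A \<and> UNIV \<subseteq> closure A" by simp
  qed (auto simp: countable_Zlat)
  moreover have "\<Inter>?G = {}"
  proof -
    have "x \<notin> \<Inter>?G" for x
    proof -
      obtain z t where "z \<in> Zlat" "t \<in> T" "x = t + z" using cover by blast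
      then show ?thesis by (auto intro!: bexI[of _ z] image_eqI[of _ _ t] simp: add.commute)
    qed
    then show ?thesis by blast
  qed
  ultimately show False by simp
qed

section \<open>Small affine pieces and regular closedness\<close>

text \<open>Following the digits of \<open>x\<close> for \<open>n\<close> levels in \<open>S\<close>
  yields one affine map that also sends \<open>T\<close> into itself. This localises
  \<open>x\<close> in a piece of \<open>T\<close> at scale \<open>L ^^ n\<close>, even before
  \<open>x\<close> is known to lie in \<open>T\<close>.\<close>

lemma self_affine_pieces:
  fixes L :: "real^3 \<Rightarrow> real^3"
  assumes L: "linear L" and T: "(\<Union>k\<in>D. (\<lambda>x. L (x + k)) ` T) \<subseteq> T"
    and S: "S \<subseteq> (\<Union>k\<in>D. (\<lambda>x. L (x + k)) ` S)" and x: "x \<in> S"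
  shows "\<exists>d. \<exists>y\<in>S. x = (L ^^ n) y + d \<and> (\<lambda>y. (L ^^ n) y + d) ` T \<subseteq> T"
  using x
proof (induction n arbitrary: x)
  case 0
  then show ?case by (intro exI[of _ 0]) auto
next
  case (Suc n)
  obtain y k where y: "y \<in> S" "k \<in> D" "x = L (y + k)" using Suc.prems S by blast
  obtain d y' where d: "y' \<in> S" "y = (L ^^ n) y' + d" "(\<lambda>y. (L ^^ n) y + d) ` T \<subseteq> T"
    using Suc.IH[OF y(1)] by blast
  have eq: "(L ^^ Suc n) w + L (d + k) = L (((L ^^ n) w + d) + k)" for w
    by (simp add: linear_add[OF L] add.assoc)
  have "L (((L ^^ n) w + d) + k) \<in> T" if "w \<in> T" for w
    using that d(3) y(2) T by blast
  then show ?case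
    using d(1,2) y(3) eq by (intro exI[of _ "L (d + k)"] bexI[of _ y']) auto
qed

text \<open>Each point lies in an arbitrarily small affine copy of \<open>T\<close> inside
  \<open>T\<close>, and the copy of an interior point is interior.\<close>

lemma self_affine_regular_closed:
  fixes L :: "real^3 \<Rightarrow> real^3"
  assumes L: "linear L" "inj L"
    and contr: "\<And>e. e > 0 \<Longrightarrow> \<exists>n. \<forall>x. norm ((L ^^ n) x) \<le> e * norm x"
    and T: "T = (\<Union>k\<in>D. (\<lambda>x. L (x + k)) ` T)" and "compact T" "interior T \<noteq> {}"
  shows "T \<subseteq> closure (interior T)"
proof
  fix x assume x: "x \<in> T"
  obtain p where p: "p \<in> interior T" using assms by auto
  obtain B where B: "B > 0" "\<And>x. x \<in> T \<Longrightarrow> norm x \<le> B"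
    using compact_imp_bounded[OF \<open>compact T\<close>] by (auto simp: bounded_pos)
  show "x \<in> closure (interior T)"
    unfolding closure_approachable
  proof (intro allI impI)
    fix e :: real assume e: "e > 0"
    \<comment> \<open>Points of \<open>T\<close> are at most \<open>2 * B\<close> apart, so this
      factor confines the copy to diameter \<open>e/2\<close>.\<close>
    then obtain n where n: "\<And>x. norm ((L ^^ n) x) \<le> e / (4 * B) * norm x" 
      using contr[of "e / (4 * B)"] B by auto
    obtain d y where d: "y \<in> T" "x = (L ^^ n) y + d" "(\<lambda>y. (L ^^ n) y + d) ` T \<subseteq> T"
      using self_affine_pieces[OF L(1) eq_refl[OF T[symmetric]] eq_refl[OF T] x] by blast
    have lin: "linear (L ^^ n)" "inj (L ^^ n)" using linear_funpow[OF L(1)] inj_fn[OF L(2)] by auto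
    have "open ((L ^^ n) ` interior T)"
      using lin by (intro open_surjective_linear_image linear_inj_imp_surj) auto
    then have "open ((\<lambda>y. d + y) ` (L ^^ n) ` interior T)" by (rule open_translation)
    moreover have "(\<lambda>y. d + y) ` (L ^^ n) ` interior T \<subseteq> T"
      using d(3) interior_subset[of T] by (force simp: add.commute)
    ultimately have "(\<lambda>y. d + y) ` (L ^^ n) ` interior T \<subseteq> interior T" by (rule interior_maximal[rotated])
    then have "(L ^^ n) p + d \<in> interior T" using p by (auto simp: add.commute)
    moreover have "dist ((L ^^ n) p + d) x < e"
    proof -
      have "norm (p - y) \<le> 2 * B"
        using B(2)[OF d(1)] B(2)[of p] p interior_subset[of T] norm_triangle_ineq4[of p y] by force
      then have "e / (4 * B) * norm (p - y) \<le> e / (4 * B) * (2 * B)"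
        using e B by (intro mult_left_mono) auto
      also have "\<dots> < e" using e B by simp
      finally have "norm ((L ^^ n) (p - y)) < e" using n[of "p - y"] by linarith
      then show ?thesis by (simp add: d(2) dist_norm linear_diff[OF lin(1)])
    qed
    ultimately show "\<exists>y\<in>interior T. dist y x < e" by blast
  qed
qed

section \<open>Neighbours of a tile\<close>

lemma tile_regular_closed:
  assumes "self_affine_lattice_tile T" "lattice_tiling T"
  shows "T \<subseteq> closure (interior T)"
proof -
  obtain M D where M: "expanding M" "compact T" "T = (\<Union>k\<in>D. (\<lambda>x. matrix_inv M *v (x + k)) ` T)"
    using assms(1) unfolding self_affine_lattice_tile_def by blast
  have inv: "invertible M" by (rule expanding_imp_invertible[OF M(1)])
  then have "inj ((*v) (matrix_inv M))"
    by (metis injI matrix_inv_mul_vector(1))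
  moreover have "interior T \<noteq> {}"
    using lattice_cover_interior_nonempty[OF M(2)] assms(2) by (auto simp: lattice_tiling_def)
  ultimately show ?thesis
    using self_affine_regular_closed[of "(*v) (matrix_inv M)" T D]
      expanding_imp_contraction(2)[OF M(1)] M(2,3) by auto
qed

text \<open>A boundary point of the translate inside \<open>interior T\<close> would have interior
  points of the translate nearby, and two interiors would meet.\<close>

lemma tile_translate_disjoint:
  assumes T: "lattice_tiling T" "T \<subseteq> closure (interior T)" and z: "z \<in> Zlat" "z \<noteq> 0"
  shows "interior T \<inter> (\<lambda>x. x + z) ` T = {}"
proof (rule ccontr)
  assume "\<not> ?thesis"
  then obtain t where t: "t \<in> T" "t + z \<in> interior T" by auto
  then have "t \<in> closure (interior T)" using T by auto
  moreover have "open ((\<lambda>x. - z + x) ` interior T)" by (intro open_translation open_interior)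
  moreover have "t \<in> (\<lambda>x. - z + x) ` interior T"
    using t(2) by (auto intro!: image_eqI[of _ _ "t + z"])
  ultimately obtain s where s: "s \<in> interior T" "s \<in> (\<lambda>x. - z + x) ` interior T"
    by (meson closure_iff_nhds_not_empty disjoint_iff open_Int_closure_eq_empty)
  have "interior ((\<lambda>x. x + 0) ` T) \<inter> interior ((\<lambda>x. x + z) ` T) = {}"
    using T(1) z Zlat_zero unfolding lattice_tiling_def by metis
  moreover have "interior ((\<lambda>x. x + z) ` T) = (\<lambda>x. x + z) ` interior T"
    using interior_translation[of z T] by (simp add: add.commute)
  moreover have "s + z \<in> interior T" using s(2) by auto
  ultimately show False using s(1) by auto
qed

text \<open>The other translates form a closed set; its complement is open and covered by
  \<open>T\<close> alone, hence lies in the interior of \<open>T\<close>.\<close>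

lemma noninterior_in_translate:
  assumes "lattice_tiling T" "compact T" "c \<notin> interior T"
  obtains z where "z \<in> Zlat" "z \<noteq> 0" "c - z \<in> T"
proof -
  let ?A = "\<Union>z\<in>Zlat - {0}. (\<lambda>x. x + z) ` T"
  have "open (- ?A)" using closed_lattice_translates[OF assms(2), of "Zlat - {0}"] by blast
  moreover have "- ?A \<subseteq> T"
  proof
    fix x assume x: "x \<in> - ?A"
    obtain z where "z \<in> Zlat" "x \<in> (\<lambda>x. x + z) ` T"
      using assms(1) unfolding lattice_tiling_def by blast
    then show "x \<in> T" using x by (cases "z = 0") auto
  qed
  ultimately have "- ?A \<subseteq> interior T" by (rule interior_maximal[rotated])
  then have "c \<in> ?A" using assms(3) by blast
  then obtain z t where "z \<in> Zlat" "z \<noteq> 0" "t \<in> T" "c = t + z" by blast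
  then show ?thesis using that[of z] by simp
qed

text \<open>Consecutive members of the chain \<open>T + (2k+1)z\<close> share the point \<open>c + 2(k+1)z\<close>.\<close>

lemma symmetric_chain:
  fixes T :: "(real^3) set"
  assumes T: "connected T" and z: "c - z \<in> T" "c + z \<in> T" "z \<noteq> 0"
  defines "S \<equiv> \<Union>k::nat. (\<lambda>x. (2 * real k + 1) *\<^sub>R z + x) ` T"
  shows "connected S" "\<not> bounded S" "c \<in> S"
proof -
  define A where "A k = (\<lambda>x. (2 * real k + 1) *\<^sub>R z + x) ` T" for k
  have A: "connected (A k)" for k unfolding A_def by (intro connected_continuous_image T continuous_intros)
  have m1: "c + (2 * real k) *\<^sub>R z \<in> A k" for k
    unfolding A_def by (rule image_eqI[OF _ z(1)]) (simp add: vec_eq_iff algebra_simps)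
  have m2: "c + (2 * real (Suc k)) *\<^sub>R z \<in> A k" for k
    unfolding A_def by (rule image_eqI[OF _ z(2)]) (simp add: vec_eq_iff algebra_simps)
  have fin: "connected (\<Union>k\<le>n. A k)" for n
  proof (induction n)
    case (Suc n)
    have "(\<Union>k\<le>Suc n. A k) = (\<Union>k\<le>n. A k) \<union> A (Suc n)" by (auto simp: atMost_Suc)
    moreover have "(\<Union>k\<le>n. A k) \<inter> A (Suc n) \<noteq> {}" using m2[of n] m1[of "Suc n"] by blast
    ultimately show ?case using Suc A connected_Un by metis
  qed (simp add: A)
  have S: "S = (\<Union>n. \<Union>k\<le>n. A k)" unfolding S_def A_def by auto
  have "c \<in> A 0" using m1[of 0] by simp
  then show "c \<in> S" unfolding S by auto
  show "connected S" unfolding S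
    by (rule connected_Union) (use fin \<open>c \<in> A 0\<close> in auto)
  show "\<not> bounded S"
  proof
    assume "bounded S"
    then obtain B where B: "\<And>x. x \<in> S \<Longrightarrow> norm x \<le> B" by (auto simp: bounded_iff)
    obtain k :: nat where k: "real k > (B + norm c) / norm z" using reals_Archimedean2 by blast
    have "c + (2 * real k) *\<^sub>R z \<in> S" using m1[of k] unfolding S by auto
    then have "norm (c + (2 * real k) *\<^sub>R z) \<le> B" by (rule B)
    then have "norm ((2 * real k) *\<^sub>R z) \<le> B + norm c"
      using norm_triangle_ineq4[of "c + (2 * real k) *\<^sub>R z" c] by simp
    then have "2 * real k * norm z \<le> B + norm c" by simp
    moreover have "real k * norm z > B + norm c" using k z(3) by (simp add: field_simps)
    moreover have "real k * norm z \<ge> 0" by simp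
    ultimately show False by linarith
  qed
qed

section \<open>Subsets and connectedness of the attractor\<close>

text \<open>Near any \<open>x\<close> in \<open>S\<close> there is a small copy of \<open>T\<close>
  within \<open>T\<close>, so \<open>x\<close> is a limit of points of \<open>T\<close>. Applied to
  finite orbits it produces points of a twindragon, applied to -T its symmetry.\<close>

lemma self_affine_attractor:
  fixes L :: "real^3 \<Rightarrow> real^3"
  assumes L: "linear L"
    and contr: "\<And>e. e > 0 \<Longrightarrow> \<exists>n. \<forall>x. norm ((L ^^ n) x) \<le> e * norm x"
    and T: "(\<Union>k\<in>D. (\<lambda>x. L (x + k)) ` T) \<subseteq> T" "closed T" "T \<noteq> {}"
    and S: "S \<subseteq> (\<Union>k\<in>D. (\<lambda>x. L (x + k)) ` S)" "bounded S"
  shows "S \<subseteq> T"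
proof
  fix x assume x: "x \<in> S"
  obtain t where t: "t \<in> T" using T by auto
  obtain B where B: "B > 0" "\<And>x. x \<in> S \<Longrightarrow> norm x \<le> B"
    using S(2) by (auto simp: bounded_pos)
  have "x \<in> closure T"
    unfolding closure_approachable
  proof (intro allI impI)
    fix e :: real assume e: "e > 0"
    define C where "C = 2 * (norm t + B)"
    have C: "C > 0" using B by (simp add: C_def add_nonneg_pos)
    then obtain n where n: "\<And>x. norm ((L ^^ n) x) \<le> e / C * norm x"
      using contr[of "e / C"] e by auto
    obtain d y where d: "y \<in> S" "x = (L ^^ n) y + d" "(\<lambda>y. (L ^^ n) y + d) ` T \<subseteq> T"
      using self_affine_pieces[OF L T(1) S(1) x] by blast
    have "norm (t - y) \<le> norm t + B"
      using B(2)[OF d(1)] norm_triangle_ineq4[of t y] by linarith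
    also have "\<dots> < C" using C by (simp add: C_def)
    finally have "e / C * norm (t - y) < e / C * C"
      using e C by (intro mult_strict_left_mono) auto
    then have "norm ((L ^^ n) (t - y)) < e" using n[of "t - y"] C by simp
    then have "dist ((L ^^ n) t + d) x < e"
      by (simp add: d(2) dist_norm linear_diff[OF linear_funpow[OF L]])
    moreover have "(L ^^ n) t + d \<in> T" using d(3) t by auto
    ultimately show "\<exists>y\<in>T. dist y x < e" by blast
  qed
  then show "x \<in> T" using T(2) by simp
qed

text \<open>In a separation of \<open>T\<close> the two parts have positive distance, so membership
  in \<open>A\<close> is constant on all sufficiently small pieces. As first-level pieces meet, this
  constancy passes up to all of \<open>T\<close>.\<close>

lemma self_affine_connected:
  fixes L :: "real^3 \<Rightarrow> real^3"
  assumes L: "linear L"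
    and contr: "\<And>e. e > 0 \<Longrightarrow> \<exists>n. \<forall>x. norm ((L ^^ n) x) \<le> e * norm x"
    and T: "T = (\<Union>k\<in>D. (\<lambda>x. L (x + k)) ` T)" "compact T"
    and meet: "\<And>k k'. k \<in> D \<Longrightarrow> k' \<in> D \<Longrightarrow> (\<lambda>x. L (x + k)) ` T \<inter> (\<lambda>x. L (x + k')) ` T \<noteq> {}"
  shows "connected T"
proof (rule ccontr)
  assume "\<not> connected T"
  then obtain A B where AB: "closed A" "closed B" "A \<noteq> {}" "B \<noteq> {}" "A \<union> B = T" "A \<inter> B = {}"
    using connected_closed_set[OF compact_imp_closed[OF T(2)]] by blast
  have "compact A" using AB T(2) compact_Int_closed[of T A] by (metis Int_absorb1 Un_upper1)
  then obtain \<delta> where \<delta>: "\<delta> > 0" "\<And>x y. x \<in> A \<Longrightarrow> y \<in> B \<Longrightarrow> \<delta> \<le> dist x y"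
    using separate_compact_closed[of A B] AB by blast
  \<comment> \<open>The induction removes the outermost map: the hypothesis applies to
    \<open>g\<close> composed with each first-level map, and common points link the pieces.\<close>
  have const: "\<forall>x\<in>T. \<forall>y\<in>T. g x = g y"
    if "\<And>d x y. (\<lambda>y. (L ^^ n) y + d) ` T \<subseteq> T \<Longrightarrow> x \<in> T \<Longrightarrow> y \<in> T \<Longrightarrow> g ((L ^^ n) x + d) = g ((L ^^ n) y + d)"
    for n and g :: "real^3 \<Rightarrow> bool"
    using that
  proof (induction n arbitrary: g)
    case 0
    show ?case
    proof (intro ballI)
      fix x y assume "x \<in> T" "y \<in> T"
      then show "g x = g y" using 0[of 0 x y] by simp
    qed
  next
    case (Suc n)
    have gk: "\<forall>x\<in>T. \<forall>y\<in>T. g (L (x + k)) = g (L (y + k))" if k: "k \<in> D" for k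
    proof (rule Suc.IH)
      fix d x y assume d: "(\<lambda>y. (L ^^ n) y + d) ` T \<subseteq> T" and xy: "x \<in> T" "y \<in> T"
      have eq: "(L ^^ Suc n) w + L (d + k) = L (((L ^^ n) w + d) + k)" for w
        by (simp add: linear_add[OF L] add.assoc)
      have "L (((L ^^ n) w + d) + k) \<in> T" if "w \<in> T" for w
      proof -
        have "(L ^^ n) w + d \<in> T" using d that by auto
        then show ?thesis using k by (subst T(1)) blast
      qed
      then have "(\<lambda>y. (L ^^ Suc n) y + L (d + k)) ` T \<subseteq> T" unfolding eq by blast
      from Suc.prems[OF this xy] show "g (L (((L ^^ n) x + d) + k)) = g (L (((L ^^ n) y + d) + k))"
        unfolding eq .
    qed
    show ?case
    proof (intro ballI)
      fix x y assume "x \<in> T" "y \<in> T"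
      then obtain k k' x' y' where k: "k \<in> D" "k' \<in> D" "x' \<in> T" "y' \<in> T" "x = L (x' + k)" "y = L (y' + k')"
        using T(1) by blast
      obtain u u' where "u \<in> T" "u' \<in> T" "L (u + k) = L (u' + k')"
        using meet[OF k(1,2)] by blast
      then show "g x = g y" using gk k by metis
    qed
  qed
  obtain C where C: "C > 0" "\<And>x. x \<in> T \<Longrightarrow> norm x \<le> C"
    using compact_imp_bounded[OF T(2)] by (auto simp: bounded_pos)
  obtain n where n: "\<And>x. norm ((L ^^ n) x) \<le> \<delta> / (4 * C) * norm x"
    using contr[of "\<delta> / (4 * C)"] \<delta> C by auto
  have "\<forall>x\<in>T. \<forall>y\<in>T. (x \<in> A) = (y \<in> A)"
  proof (rule const[of n])
    fix d x y assume d: "(\<lambda>y. (L ^^ n) y + d) ` T \<subseteq> T" and xy: "x \<in> T" "y \<in> T"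
    let ?x = "(L ^^ n) x + d" and ?y = "(L ^^ n) y + d"
    have "norm (x - y) \<le> 2 * C" using C(2)[OF xy(1)] C(2)[OF xy(2)] norm_triangle_ineq4[of x y] by linarith
    then have "\<delta> / (4 * C) * norm (x - y) \<le> \<delta> / (4 * C) * (2 * C)"
      using \<delta> C by (intro mult_left_mono) auto
    also have "\<dots> < \<delta>" using \<delta> C by simp
    finally have "norm ((L ^^ n) (x - y)) < \<delta>" using n[of "x - y"] by linarith
    then have "dist ?x ?y < \<delta>" by (simp add: dist_norm linear_diff[OF linear_funpow[OF L]])
    moreover have "?x \<in> A \<union> B" "?y \<in> A \<union> B" using d xy AB(5) by auto
    ultimately show "(?x \<in> A) = (?y \<in> A)"
      using \<delta>(2)[of ?x ?y] \<delta>(2)[of ?y ?x] by (auto simp: dist_commute)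
  qed
  then show False using AB by blast
qed

section \<open>Covering by lattice translates and measure of overlaps\<close>

text \<open>The union of the translates is closed, so density suffices. An approximation of
  \<open>M *v x - k1\<close> is pulled back by the inverse matrix: the residue system rewrites it as
  a piece of \<open>T\<close> plus a lattice vector, and the error gains one factor of the
  contraction.\<close>

lemma self_affine_lattice_cover:
  assumes M: "expanding M" and D: "digit_set M D"
    and T: "compact T" "T \<noteq> {}" "T = (\<Union>k\<in>D. (\<lambda>x. matrix_inv M *v (x + k)) ` T)"
  shows "(\<Union>z\<in>Zlat. (\<lambda>x. x + z) ` T) = UNIV"
proof -
  let ?L = "(*v) (matrix_inv M)"
  let ?X = "\<Union>z\<in>Zlat. (\<lambda>x. x + z) ` T"
  have inv: "invertible M" by (rule expanding_imp_invertible[OF M])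
  obtain k1 where "k1 \<in> D" and k1: "\<forall>z\<in>Zlat. \<exists>!k. k \<in> D \<and> z - (k - k1) \<in> (\<lambda>y. M *v y) ` Zlat"
    using D unfolding digit_set_def by blast
  obtain t where t: "t \<in> T" using T by auto
  have near: "\<exists>p\<in>?X. \<exists>q. norm q \<le> 3 \<and> x - p = (?L ^^ n) q" for n x
  proof (induction n arbitrary: x)
    case 0
    \<comment> \<open>Rounding down leaves three coordinates in [0, 1), whence the bound 3.\<close>
    define z :: "real^3" where "z = (\<chi> i. of_int \<lfloor>(x - t) $ i\<rfloor>)"
    have "norm (x - t - z) \<le> (\<Sum>i\<in>UNIV. \<bar>(x - t - z) $ i\<bar>)" by (rule norm_le_l1_cart)
    also have "\<dots> \<le> (\<Sum>i\<in>(UNIV::3 set). 1)"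
      by (intro sum_mono) (simp add: z_def, linarith)
    finally have "norm (x - (t + z)) \<le> 3" by (simp add: algebra_simps)
    moreover have "z \<in> Zlat" by (simp add: z_def Zlat_def)
    then have "t + z \<in> ?X" using t by blast
    ultimately show ?case by (intro bexI[of _ "t + z"] exI[of _ "x - (t + z)"]) auto
  next
    case (Suc n)
    obtain p q where p: "p \<in> ?X" "norm q \<le> 3" "(M *v x - k1) - p = (?L ^^ n) q"
      using Suc[of "M *v x - k1"] by blast
    obtain s z where z: "s \<in> T" "z \<in> Zlat" "p = s + z" using p(1) by blast
    obtain k z' where k: "k \<in> D" "z' \<in> Zlat" "z - (k - k1) = M *v z'" using bspec[OF k1 z(2)] by (elim ex1E conjE imageE) blast
    have "p + k1 = (s + k) + M *v z'" using k(3) z(3) by (simp add: algebra_simps)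
    then have "?L (p + k1) = ?L (s + k) + z'"
      by (simp add: matrix_vector_right_distrib matrix_inv_mul_vector[OF inv])
    moreover have "?L (s + k) \<in> T" using z(1) k(1) by (subst T(3)) blast
    ultimately have "?L (p + k1) \<in> ?X" using k(2) by auto
    moreover have "x - ?L (p + k1) = (?L ^^ Suc n) q"
    proof -
      have "(?L ^^ Suc n) q = ?L (M *v x - (p + k1))" using p(3) by (simp add: algebra_simps)
      also have "\<dots> = x - ?L (p + k1)"
        by (simp add: matrix_vector_mult_diff_distrib matrix_inv_mul_vector[OF inv])
      finally show ?thesis by simp
    qed
    ultimately show ?case using p(2) by blast
  qed
  have "x \<in> closure ?X" for x
    unfolding closure_approachable
  proof (intro allI impI)
    fix e :: real assume e: "e > 0"
    obtain n where n: "\<And>x. norm ((?L ^^ n) x) \<le> e / 4 * norm x"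
      using expanding_imp_contraction(2)[OF M, of "e / 4"] e by auto
    obtain p q where p: "p \<in> ?X" "norm q \<le> 3" "x - p = (?L ^^ n) q" using near by blast
    have "norm (x - p) \<le> e / 4 * norm q" unfolding p(3) by (rule n)
    also have "\<dots> \<le> e / 4 * 3" using p(2) e by (intro mult_left_mono) auto
    finally have "dist p x < e" using e by (simp add: dist_norm norm_minus_commute)
    then show "\<exists>y\<in>?X. dist y x < e" using p(1) by blast
  qed
  moreover have "closure ?X = ?X" by (intro closure_closed closed_lattice_translates T(1) order_refl)
  ultimately show ?thesis by (metis UNIV_eq_I)
qed

lemma negligible_matrix_image:
  fixes M :: "real^3^3"
  assumes "negligible S" shows "negligible ((*v) M ` S)"
proof -
  have S: "S \<in> lmeasurable" "measure lebesgue S = 0" using assms by (auto simp: negligible_iff_measure)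
  have "measure lebesgue ((*v) M ` S) = 0" "(*v) M ` S \<in> lmeasurable"
    using measure_linear_image[of "(*v) M" S] measurable_linear_image[of "(*v) M" S] S by auto
  then show ?thesis by (simp add: negligible_iff_measure)
qed

lemma matrix_image_self_affine:
  fixes M :: "real^3^3"
  assumes inv: "invertible M" and T: "T = (\<Union>k\<in>D. (\<lambda>x. matrix_inv M *v (x + k)) ` T)"
  shows "(*v) M ` T = (\<Union>k\<in>D. (\<lambda>x. x + k) ` T)"
proof -
  have "(*v) M ` T = (*v) M ` (\<Union>k\<in>D. (\<lambda>x. matrix_inv M *v (x + k)) ` T)" using T by simp
  also have "\<dots> = (\<Union>k\<in>D. (\<lambda>x. x + k) ` T)"
    by (simp add: image_UN image_image matrix_inv_mul_vector[OF inv])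
  finally show ?thesis .
qed

text \<open>Up to translation the new overlap is (T + k) \<inter> (T + k' + M z), which lies in the
  image under \<open>M\<close> of T \<inter> (T + z).\<close>

lemma negligible_overlap_step:
  fixes M :: "real^3^3"
  assumes inv: "invertible M" and T: "T = (\<Union>k\<in>D. (\<lambda>x. matrix_inv M *v (x + k)) ` T)"
    and z: "negligible (T \<inter> (\<lambda>x. x + z) ` T)" and k: "k \<in> D" "k' \<in> D"
  shows "negligible (T \<inter> (\<lambda>x. x + (M *v z + (k' - k))) ` T)"
proof -
  have "(\<lambda>x. k + x) ` (T \<inter> (\<lambda>x. x + (M *v z + (k' - k))) ` T) \<subseteq> (*v) M ` (T \<inter> (\<lambda>x. x + z) ` T)"
  proof
    fix y assume "y \<in> (\<lambda>x. k + x) ` (T \<inter> (\<lambda>x. x + (M *v z + (k' - k))) ` T)"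
    then obtain s t where st: "s \<in> T" "t \<in> T" "y = s + k" "y = (t + k') + M *v z"
      by (auto simp: algebra_simps)
    have "s + k \<in> (*v) M ` T" "t + k' \<in> (*v) M ` T"
      unfolding matrix_image_self_affine[OF inv T] using st k by blast+
    then obtain s' t' where s': "s' \<in> T" "s + k = M *v s'" "t' \<in> T" "t + k' = M *v t'" by blast
    then have "M *v s' = M *v (t' + z)" using st by (simp add: matrix_vector_right_distrib)
    then have "s' = t' + z" by (metis matrix_inv_mul_vector(2)[OF inv])
    then show "y \<in> (*v) M ` (T \<inter> (\<lambda>x. x + z) ` T)" using s' st by auto
  qed
  then have "negligible ((\<lambda>x. k + x) ` (T \<inter> (\<lambda>x. x + (M *v z + (k' - k))) ` T))"
    using negligible_matrix_image[OF z] negligible_subset by blast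
  then show ?thesis by (rule negligible_translation_rev)
qed

text \<open>The image of \<open>T\<close> under \<open>M\<close> has twice the volume of
  \<open>T\<close> and is the union of two translates of \<open>T\<close>, which leaves no volume
  for their intersection.\<close>

lemma negligible_overlap_two_digits:
  fixes M :: "real^3^3"
  assumes inv: "invertible M" and T: "T = (\<Union>k\<in>{k, k'}. (\<lambda>x. matrix_inv M *v (x + k)) ` T)"
    and det: "\<bar>det M\<bar> = 2" and c: "compact T"
  shows "negligible (T \<inter> (\<lambda>x. x + (k' - k)) ` T)"
proof -
  have Tm: "T \<in> lmeasurable" using c by (rule lmeasurable_compact)
  let ?A = "(\<lambda>x. k + x) ` T" and ?B = "(\<lambda>x. k' + x) ` T"
  have m: "?A \<in> lmeasurable" "?B \<in> lmeasurable" using Tm by (auto intro: measurable_translation)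
  have "measure lebesgue ((*v) M ` T) = 2 * measure lebesgue T"
    using measure_linear_image[of "(*v) M" T] Tm det by simp
  moreover have "(*v) M ` T = ?A \<union> ?B"
    using matrix_image_self_affine[OF inv T] by (simp add: add.commute)
  moreover have "measure lebesgue (?A \<union> ?B) = measure lebesgue ?A + measure lebesgue ?B - measure lebesgue (?A \<inter> ?B)"
    using m by (rule measure_Un3)
  moreover have "measure lebesgue ?A = measure lebesgue T" "measure lebesgue ?B = measure lebesgue T"
    by (simp_all add: measure_translation)
  ultimately have "measure lebesgue (?A \<inter> ?B) = 0" by simp
  then have "negligible (?A \<inter> ?B)" using m by (simp add: negligible_iff_measure fmeasurable.Int)
  moreover have "?A \<inter> ?B = (\<lambda>x. k + x) ` (T \<inter> (\<lambda>x. x + (k' - k)) ` T)"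
  proof -
    have "(\<lambda>x. k + x) ` (\<lambda>x. x + (k' - k)) ` T = ?B" by (simp add: image_image algebra_simps)
    then show ?thesis by (metis image_Int inj_on_add)
  qed
  ultimately show ?thesis using negligible_translation_rev by metis
qed

lemma negligible_overlap_interiors_disjoint:
  fixes T :: "(real^3) set"
  assumes "negligible (T \<inter> (\<lambda>x. x + (z' - z)) ` T)"
  shows "interior ((\<lambda>x. x + z) ` T) \<inter> interior ((\<lambda>x. x + z') ` T) = {}"
proof (rule ccontr)
  assume ne: "interior ((\<lambda>x. x + z) ` T) \<inter> interior ((\<lambda>x. x + z') ` T) \<noteq> {}"
  have "(\<lambda>x. z + x) ` (T \<inter> (\<lambda>x. x + (z' - z)) ` T) = (\<lambda>x. x + z) ` T \<inter> (\<lambda>x. x + z') ` T"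
    by (subst image_Int) (auto simp: image_image algebra_simps)
  then have "negligible ((\<lambda>x. x + z) ` T \<inter> (\<lambda>x. x + z') ` T)"
    using negligible_translation[OF assms, of z] by simp
  then have "negligible (interior ((\<lambda>x. x + z) ` T) \<inter> interior ((\<lambda>x. x + z') ` T))"
    by (rule negligible_subset) (intro Int_mono interior_subset)
  then show False using ne open_not_negligible[OF open_Int[OF open_interior open_interior]] by blast
qed

section \<open>Symmetric tiles whose center is not interior\<close>

lemma symmetric_tile_interior_not_simply_connected:
  fixes T :: "(real^3) set"
  assumes tile: "self_affine_lattice_tile T" "connected T" "lattice_tiling T"
    and sym: "(\<lambda>x. 2 *\<^sub>R c - x) ` T = T" and c: "c \<notin> interior T"
  shows "\<not> simply_connected (interior T)"
proof -
  have T: "compact T" using tile(1) unfolding self_affine_lattice_tile_def by blast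
  have reg: "T \<subseteq> closure (interior T)" by (rule tile_regular_closed[OF tile(1,3)])
  have ne: "interior T \<noteq> {}"
    using lattice_cover_interior_nonempty[OF T] tile(3) by (simp add: lattice_tiling_def)
  obtain z where z: "z \<in> Zlat" "z \<noteq> 0" "c - z \<in> T"
    using noninterior_in_translate[OF tile(3) T c] by blast
  have "2 *\<^sub>R c - (c - z) \<in> T" using sym z(3) by blast
  then have z': "c + z \<in> T" by (simp add: scaleR_2 algebra_simps)
  \<comment> \<open>Only odd multiples of \<open>z\<close> occur; they are nonzero lattice vectors,
    so every member of the chain misses the interior of \<open>T\<close>.\<close>
  define S where "S = (\<Union>k::nat. (\<lambda>x. (2 * real k + 1) *\<^sub>R z + x) ` T)"
  note S = symmetric_chain[OF tile(2) z(3) z' z(2), folded S_def]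
  have dis: "S \<inter> interior T = {}"
  proof -
    have "interior T \<inter> (\<lambda>x. x + (2 * real k + 1) *\<^sub>R z) ` T = {}" for k
    proof (rule tile_translate_disjoint[OF tile(3) reg])
      show "(2 * real k + 1) *\<^sub>R z \<in> Zlat" by (rule Zlat_scale[OF z(1)]) auto
      have "2 * real k + 1 \<noteq> 0" by linarith
      then show "(2 * real k + 1) *\<^sub>R z \<noteq> 0" using z(2) by simp
    qed
    then show ?thesis unfolding S_def by (auto simp: add.commute)
  qed
  have symint: "2 *\<^sub>R c - x \<in> interior T" if "x \<in> interior T" for x
  proof -
    have "open ((\<lambda>x. 2 *\<^sub>R c + x) ` uminus ` interior T)"
      by (intro open_translation open_negations open_interior)
    moreover have "(\<lambda>x. 2 *\<^sub>R c + x) ` uminus ` interior T \<subseteq> T"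
    proof -
      have "2 *\<^sub>R c + - y \<in> T" if "y \<in> interior T" for y
      proof -
        have "2 *\<^sub>R c - y \<in> T" using sym that interior_subset by blast
        then show ?thesis by simp
      qed
      then show ?thesis by blast
    qed
    ultimately have "(\<lambda>x. 2 *\<^sub>R c + x) ` uminus ` interior T \<subseteq> interior T" by (rule interior_maximal[rotated])
    then have "2 *\<^sub>R c + - x \<in> interior T" using that by blast
    then show ?thesis by simp
  qed
  let ?t = "\<lambda>x. - c + x"
  have "\<not> simply_connected (?t ` interior T)"
  proof (rule symmetric_not_simply_connected)
    show "open (?t ` interior T)" by (intro open_translation open_interior)
    show "?t ` interior T \<noteq> {}" using ne by simp
    show "uminus ` ?t ` interior T \<subseteq> ?t ` interior T"
    proof -
      have "- (- c + y) \<in> ?t ` interior T" if "y \<in> interior T" for y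
        by (rule image_eqI[OF _ symint[OF that]]) (simp add: scaleR_2)
      then show ?thesis by blast
    qed
    show "connected (?t ` S)" by (intro connected_continuous_image S continuous_intros)
    show "\<not> bounded (?t ` S)"
    proof
      assume "bounded (?t ` S)"
      then have "bounded ((\<lambda>x. c + x) ` ?t ` S)" by (rule bounded_translation)
      then show False using S(2) by (simp add: image_image)
    qed
    show "?t ` S \<inter> ?t ` interior T = {}" using dis by auto
    show "0 \<in> ?t ` S" by (rule image_eqI[OF _ S(3)]) simp
  qed
  then show ?thesis
    using homeomorphic_simply_connected_eq[OF homeomorphic_translation[of "interior T" "- c"]] by simp
qed

section \<open>Twindragons\<close>

lemma twin_matrix_mult:
  "twin_matrix a b *v v = vector [2 * v$3, v$1 + of_int b * v$3, v$2 + of_int a * v$3]"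
  by (simp add: twin_matrix_def vec_eq_iff forall_3 matrix_vector_mult_def sum_3 vector_3)

lemma e1_nth: "e1 $ 1 = 1" "e1 $ 2 = 0" "e1 $ 3 = 0"
  by (simp_all add: e1_def vector_3)

lemma det_twin_matrix: "det (twin_matrix a b) = 2"
  by (simp add: twin_matrix_def det_3 vector_3)

text \<open>The distance 2 is the diameter of the disc, so the real parts must be extremal.\<close>

lemma unit_disc_diff_eq_2:
  fixes u v :: complex
  assumes "norm u \<le> 1" "norm v \<le> 1" "u - v = 2"
  shows "u = 1" "v = -1"
proof -
  have r: "Re u - Re v = 2" using assms(3) by (metis minus_complex.sel(1) complex_Re_numeral)
  have "Re u \<le> 1" "- Re v \<le> 1"
    using complex_Re_le_cmod[of u] abs_Re_le_cmod[of v] assms(1,2) by linarith+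
  then have re: "Re u = 1" using r by linarith
  have "(norm u)\<^sup>2 \<le> 1" using assms(1) by (simp add: power_le_one)
  then have "Im u = 0" using re by (simp add: cmod_power2)
  then show u: "u = 1" using re by (simp add: complex_eq_iff)
  show "v = -1" using assms(3) u by (simp add: algebra_simps complex_eq_iff)
qed

text \<open>A root in the closed unit disc yields two powers of \<open>z\<close> whose difference is
  2, which forces z = -1; but -1 is not a root.\<close>

lemma expanding_twin:
  assumes "(a, b) \<in> {(0, 1), (2, -2)}"
  shows "expanding (twin_matrix a b)"
  unfolding expanding_def
proof (intro allI impI)
  fix z assume "det (mat z - (\<chi> i j. complex_of_real (twin_matrix a b $ i $ j))) = 0"
  then have z: "z^3 - of_int a * z^2 - of_int b * z - 2 = 0"
    unfolding det_mat_minus_3 det_twin_matrix by (simp add: twin_matrix_def vector_3)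
  show "1 < cmod z"
  proof (rule ccontr)
    assume "\<not> 1 < cmod z"
    then have le: "cmod z \<le> 1" "cmod (z^3) \<le> 1" "cmod (z^4) \<le> 1" by (auto simp: norm_power power_le_one)
    consider "a = 0" "b = 1" | "a = 2" "b = -2" using assms by auto
    then have "z = -1"
    proof cases
      case 1
      then have "z^3 - z = 2" using z by (simp add: algebra_simps)
      then show ?thesis using unit_disc_diff_eq_2(2) le by blast
    next
      case 2
      \<comment> \<open>The factor z + 1 removes the middle terms of the characteristic
        polynomial.\<close>
      have "z^4 - z^3 - 2 = (z + 1) * (z^3 - 2 * z^2 - (-2) * z - 2)"
        by (simp add: algebra_simps eval_nat_numeral)
      then have "z^4 - z^3 = 2" using z 2 by simp
      then have "z^4 = 1" "z^3 = -1" using unit_disc_diff_eq_2 le by blast+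
      moreover have "z^4 = z^3 * z" by (simp add: eval_nat_numeral)
      ultimately have "- z = 1" by simp
      then show ?thesis by (metis minus_minus)
    qed
    then show False using z assms by auto
  qed
qed

lemma integer_twin_matrix: "integer_matrix (twin_matrix a b)"
  by (simp add: integer_matrix_def twin_matrix_def forall_3 vector_3)

definition twin_digits :: "(real^3) set" where
  "twin_digits = {- (1/2) *\<^sub>R e1, (1/2) *\<^sub>R e1}"

lemma Zlat_iff: "v \<in> Zlat \<longleftrightarrow> v$1 \<in> \<int> \<and> v$2 \<in> \<int> \<and> v$3 \<in> \<int>"
  by (simp add: Zlat_def forall_3)

lemma twin_image_Zlat:
  "v \<in> (\<lambda>y. twin_matrix a b *v y) ` Zlat \<longleftrightarrow> v \<in> Zlat \<and> v$1 / 2 \<in> \<int>"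
proof
  assume "v \<in> (\<lambda>y. twin_matrix a b *v y) ` Zlat"
  then show "v \<in> Zlat \<and> v$1 / 2 \<in> \<int>" by (auto simp: twin_matrix_mult Zlat_iff vector_3)
next
  assume v: "v \<in> Zlat \<and> v$1 / 2 \<in> \<int>"
  then have h: "real_of_int m * (v$1 / 2) \<in> \<int>" for m by (intro Ints_mult) auto
  show "v \<in> (\<lambda>y. twin_matrix a b *v y) ` Zlat"
  proof (rule image_eqI)
    let ?y = "vector [v$2 - of_int b * (v$1 / 2), v$3 - of_int a * (v$1 / 2), v$1 / 2] :: real^3"
    show "v = twin_matrix a b *v ?y" by (simp add: twin_matrix_mult vec_eq_iff forall_3 vector_3)
    show "?y \<in> Zlat" using v h[of a] h[of b] by (auto simp: Zlat_iff vector_3)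
  qed
qed

lemma e1_nonzero: "e1 \<noteq> 0"
  using e1_nth(1) by force

lemma twin_digits_distinct: "- (1/2) *\<^sub>R e1 \<noteq> (1/2) *\<^sub>R e1"
proof
  assume "- (1/2) *\<^sub>R e1 = (1/2) *\<^sub>R e1"
  then have "(- (1/2) *\<^sub>R e1) $ 1 = ((1/2) *\<^sub>R e1) $ 1" by (rule arg_cong)
  then show False by (simp add: e1_nth)
qed

text \<open>The residue class is decided by the parity of the first coordinate, and the two digits
  differ by \<open>e1\<close>.\<close>

lemma digit_set_twin: "digit_set (twin_matrix a b) twin_digits"
proof -
  let ?h = "(1/2) *\<^sub>R e1"
  have d: "?h - - (1/2) *\<^sub>R e1 = e1" by (simp add: vec_eq_iff)
  have ex1: "\<exists>!k. k \<in> twin_digits \<and> z - (k - - (1/2) *\<^sub>R e1) \<in> (\<lambda>y. twin_matrix a b *v y) ` Zlat" if z: "z \<in> Zlat" for z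
  proof -
    obtain n where n: "z$1 = of_int n" using z by (auto simp: Zlat_iff elim: Ints_cases)
    have half: "of_int m / 2 \<in> (\<int> :: real set) \<longleftrightarrow> even m" for m
    proof
      assume "of_int m / 2 \<in> (\<int> :: real set)"
      then obtain j where "of_int m / 2 = (of_int j :: real)" by (auto elim: Ints_cases)
      then have "of_int m = (of_int (2 * j) :: real)" by simp
      then show "even m" by (simp only: of_int_eq_iff) simp
    qed (auto elim!: evenE)
    have e1Z: "e1 \<in> Zlat" by (simp add: Zlat_iff e1_nth)
    have 1: "z - (- (1/2) *\<^sub>R e1 - - (1/2) *\<^sub>R e1) \<in> (\<lambda>y. twin_matrix a b *v y) ` Zlat \<longleftrightarrow> even n"
      using z n half[of n] unfolding twin_image_Zlat by simp
    have "(z - e1)$1 = of_int (n - 1)" using n by (simp add: e1_nth)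
    then have 2: "z - (?h - - (1/2) *\<^sub>R e1) \<in> (\<lambda>y. twin_matrix a b *v y) ` Zlat \<longleftrightarrow> odd n"
      using Zlat_diff[OF z e1Z] half[of "n - 1"] unfolding d twin_image_Zlat by simp
    show ?thesis
    proof (cases "even n")
      case True
      show ?thesis
        by (rule ex1I[of _ "- (1/2) *\<^sub>R e1"]) (use 1 2 True in \<open>auto simp only: twin_digits_def insert_iff empty_iff\<close>)
    next
      case False
      show ?thesis
        by (rule ex1I[of _ "?h"]) (use 1 2 False in \<open>auto simp only: twin_digits_def insert_iff empty_iff\<close>)
    qed
  qed
  have "finite twin_digits" "card twin_digits = 2"
    using twin_digits_distinct by (auto simp: twin_digits_def)
  moreover have "- (1/2) *\<^sub>R e1 \<in> twin_digits" by (simp add: twin_digits_def)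
  moreover have "\<forall>k\<in>twin_digits. k - - (1/2) *\<^sub>R e1 \<in> Zlat"
    by (auto simp: twin_digits_def Zlat_iff e1_nth)
  ultimately show ?thesis
    unfolding digit_set_def det_twin_matrix
    by (intro conjI bexI[of _ "- (1/2) *\<^sub>R e1"] ballI ex1) auto
qed

section \<open>Differences of digit expansions exhaust the lattice\<close>

text \<open>
  \<open>twin_rep a b\<close> describes the lattice points \<open>\<Sum>\<^sub>k c\<^sub>k M\<^sup>k e\<^sub>1\<close> with \<open>c\<^sub>k \<in> {-1, 0, 1}\<close>, that is, the
  differences of digit expansions. A \<open>carry_set\<close> is a set of carries that is sufficient to add one of
  its members to such a point digit by digit; this shows that all lattice points are of this form.
\<close>

inductive twin_rep :: "int \<Rightarrow> int \<Rightarrow> int \<times> int \<times> int \<Rightarrow> bool" for a b where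
  zero: "twin_rep a b (0, 0, 0)"
| step: "twin_rep a b (x, y, w) \<Longrightarrow> c \<in> {-1, 0, 1} \<Longrightarrow> twin_rep a b (2 * w + c, x + b * w, y + a * w)"

lemma twin_rep_stepI:
  "twin_rep a b (x, y, w) \<Longrightarrow> c \<in> {-1, 0, 1} \<Longrightarrow> x' = 2 * w + c \<Longrightarrow> y' = x + b * w \<Longrightarrow> w' = y + a * w
    \<Longrightarrow> twin_rep a b (x', y', w')"
  using twin_rep.step[of a b x y w c] by simp

lemma twin_rep_uminus: "twin_rep a b (x, y, w) \<Longrightarrow> twin_rep a b (- x, - y, - w)"
proof (induction "(x, y, w)" arbitrary: x y w rule: twin_rep.induct)
  case zero
  then show ?case by (simp add: twin_rep.zero)
next
  case (step x y w c)
  show ?case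
    by (rule twin_rep_stepI[OF step(2), of "- c"]) (use step(3) in \<open>auto simp: algebra_simps\<close>)
qed

definition carry_set :: "int \<Rightarrow> int \<Rightarrow> (int \<times> int \<times> int) set \<Rightarrow> bool" where
  "carry_set a b S \<longleftrightarrow> (\<forall>(x, y, w)\<in>S. \<forall>c\<in>{-1, 0, 1}. \<exists>c'\<in>{-1, 0, 1}. \<exists>(x', y', w')\<in>S.
     x + c = 2 * w' + c' \<and> y = x' + b * w' \<and> w = y' + a * w')"

text \<open>A carry s splits as s + c e1 = M s' + c' e1, hence M v + c e1 + s = M (v + s') + c' e1:
  the new lowest digit is c', and s' is passed on to v.\<close>

lemma twin_rep_carry:
  assumes S: "carry_set a b S" and base: "\<And>s. s \<in> S \<Longrightarrow> twin_rep a b s"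
  shows "twin_rep a b (x, y, w) \<Longrightarrow> (x0, y0, w0) \<in> S \<Longrightarrow> twin_rep a b (x + x0, y + y0, w + w0)"
proof (induction "(x, y, w)" arbitrary: x y w x0 y0 w0 rule: twin_rep.induct)
  case zero
  then show ?case using base by simp
next
  case (step x y w c)
  have "\<exists>c'\<in>{-1, 0, 1}. \<exists>(x', y', w')\<in>S. x0 + c = 2 * w' + c' \<and> y0 = x' + b * w' \<and> w0 = y' + a * w'"
    using bspec[OF bspec[OF S[unfolded carry_set_def] step(4), unfolded prod.case] step(3)] .
  then obtain c' p where p: "c' \<in> {-1, 0, 1}" "p \<in> S"
    "case p of (x', y', w') \<Rightarrow> x0 + c = 2 * w' + c' \<and> y0 = x' + b * w' \<and> w0 = y' + a * w'"
    by (elim bexE)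
  obtain x' y' w' where "p = (x', y', w')" by (cases p)
  with p have t: "c' \<in> {-1, 0, 1}" "(x', y', w') \<in> S"
    "x0 + c = 2 * w' + c'" "y0 = x' + b * w'" "w0 = y' + a * w'"
    by simp_all
  show ?case
    by (rule twin_rep_stepI[OF step(2)[OF t(2)] t(1)]) (use t in \<open>auto simp: algebra_simps\<close>)
qed

text \<open>The carries \<open>(1, 0, 0)\<close> and \<open>(-1, 0, 0)\<close> allow any change of
  the first coordinate. As the matrix moves the first unit vector to the second and that to the
  third, the other coordinates follow by shifting the vector one step earlier.\<close>

lemma twin_rep_all:
  assumes S: "carry_set a b S" and base: "\<And>s. s \<in> S \<Longrightarrow> twin_rep a b s"
    and e: "(1, 0, 0) \<in> S" "(-1, 0, 0) \<in> S"
  shows "twin_rep a b (x, y, w)"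
proof -
  have addx: "twin_rep a b (x + n, y, w)" if "twin_rep a b (x, y, w)" for x y w n
  proof (induction n rule: int_induct[of _ 0])
    case base
    then show ?case using that by simp
  next
    case (step1 i)
    then show ?case using twin_rep_carry[OF S base step1(2) e(1)] by (simp add: add.assoc)
  next
    case (step2 i)
    then show ?case using twin_rep_carry[OF S base step2(2) e(2)] by (simp add: algebra_simps)
  qed
  have addy: "twin_rep a b (x, y + n, w)" if "twin_rep a b (x, y, w)" for x y w n
    using that
  proof cases
    case zero
    show ?thesis
      by (rule twin_rep_stepI[OF addx[OF twin_rep.zero, of n], of 0]) (use zero in auto)
  next
    case (step x' y' w' c)
    show ?thesis
      by (rule twin_rep_stepI[OF addx[OF step(4), of n] step(5)]) (use step in auto)
  qed
  have addw: "twin_rep a b (x, y, w + n)" if "twin_rep a b (x, y, w)" for x y w n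
    using that
  proof cases
    case zero
    show ?thesis
      by (rule twin_rep_stepI[OF addy[OF twin_rep.zero, of n], of 0]) (use zero in auto)
  next
    case (step x' y' w' c)
    show ?thesis
      by (rule twin_rep_stepI[OF addy[OF step(4), of n] step(5)]) (use step in auto)
  qed
  show ?thesis using addw[OF addy[OF addx[OF twin_rep.zero, of x], of y], of w] by simp
qed

text \<open>A set of 15 carries closed under negation; \<open>carry2m2\<close> is its analogue with
  13 members. Being finite, they are checked by evaluation.\<close>

definition carry01 :: "(int \<times> int \<times> int) set" where
  "carry01 = {(-1,0,1), (0,-1,1), (0,1,0), (1,-1,0), (-2,0,1), (1,0,-1), (0,0,0), (2,0,-1),
     (-1,-1,1), (0,-1,0), (1,0,0), (-1,0,0), (-1,1,0), (1,1,-1), (0,1,-1)}"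

definition carry2m2 :: "(int \<times> int \<times> int) set" where
  "carry2m2 = {(2,-1,0), (0,-1,1), (-1,2,-1), (1,-1,0), (-2,2,-1), (0,0,0), (1,-2,1), (1,0,0),
     (-1,0,0), (-2,1,0), (-1,1,0), (2,-2,1), (0,1,-1)}"

lemma carry_set_01: "carry_set 0 1 carry01"
  unfolding carry_set_def carry01_def by code_simp

lemma carry_set_2m2: "carry_set 2 (-2) carry2m2"
  unfolding carry_set_def carry2m2_def by code_simp

lemma twin_rep_01: "twin_rep 0 1 (x, y, w)"
proof (rule twin_rep_all[OF carry_set_01])
  note st = twin_rep_stepI[where a = 0 and b = 1]
  have 1: "twin_rep 0 1 (1, 0, 0)" by (rule st[OF twin_rep.zero, of 1]) auto
  have 2: "twin_rep 0 1 (0, 1, 0)" by (rule st[OF 1, of 0]) auto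
  have 3: "twin_rep 0 1 (-1, 0, 1)" by (rule st[OF 2, of "-1"]) auto
  have 4: "twin_rep 0 1 (-1, 1, 0)" by (rule st[OF 1, of "-1"]) auto
  have 5: "twin_rep 0 1 (0, -1, 1)" by (rule st[OF 4, of 0]) auto
  have 6: "twin_rep 0 1 (-1, -1, 1)" by (rule st[OF 4, of "-1"]) auto
  have 7: "twin_rep 0 1 (1, 1, -1)" using twin_rep_uminus[OF 6] by simp
  have 8: "twin_rep 0 1 (-2, 0, 1)" by (rule st[OF 7, of 0]) auto
  note pos = 1 2 3 4 5 6 7 8
  show "twin_rep 0 1 s" if "s \<in> carry01" for s
    using that pos twin_rep.zero pos[THEN twin_rep_uminus] unfolding carry01_def by auto
qed (simp_all add: carry01_def)

lemma twin_rep_2m2: "twin_rep 2 (-2) (x, y, w)"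
proof (rule twin_rep_all[OF carry_set_2m2])
  note st = twin_rep_stepI[where a = 2 and b = "-2"]
  have 1: "twin_rep 2 (-2) (1, 0, 0)" by (rule st[OF twin_rep.zero, of 1]) auto
  have 2: "twin_rep 2 (-2) (-1, 0, 0)" using twin_rep_uminus[OF 1] by simp
  have 3: "twin_rep 2 (-2) (1, -1, 0)" by (rule st[OF 2, of 1]) auto
  have 4: "twin_rep 2 (-2) (0, 1, -1)" by (rule st[OF 3, of 0]) auto
  have 5: "twin_rep 2 (-2) (0, -1, 1)" using twin_rep_uminus[OF 4] by simp
  have 6: "twin_rep 2 (-2) (2, -2, 1)" by (rule st[OF 5, of 0]) auto
  have 7: "twin_rep 2 (-2) (1, -2, 1)" by (rule st[OF 5, of "-1"]) auto
  have 8: "twin_rep 2 (-2) (2, -1, 0)" by (rule st[OF 7, of 0]) auto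
  note pos = 1 3 4 6 7 8
  show "twin_rep 2 (-2) s" if "s \<in> carry2m2" for s
    using that pos twin_rep.zero pos[THEN twin_rep_uminus] unfolding carry2m2_def by auto
qed (simp_all add: carry2m2_def)

text \<open>At the leading nonzero digit the volume argument applies; each further digit transports
  negligibility by \<open>negligible_overlap_step\<close>.\<close>

lemma twin_overlap_negligible:
  assumes inv: "invertible (twin_matrix a b)" and T: "compact T"
    "T = (\<Union>k\<in>twin_digits. (\<lambda>x. matrix_inv (twin_matrix a b) *v (x + k)) ` T)"
  shows "twin_rep a b (x, y, w) \<Longrightarrow> (x, y, w) \<noteq> (0, 0, 0) \<Longrightarrow>
    negligible (T \<inter> (\<lambda>v. v + vector [of_int x, of_int y, of_int w]) ` T)"
proof (induction "(x, y, w)" arbitrary: x y w rule: twin_rep.induct)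
  case (step x y w c)
  let ?h = "(1/2) *\<^sub>R e1" and ?mh = "- (1/2) *\<^sub>R e1"
  have digits: "?h \<in> twin_digits" "?mh \<in> twin_digits" by (auto simp: twin_digits_def)
  obtain k k' where k: "k \<in> twin_digits" "k' \<in> twin_digits" "k' - k = of_int c *\<^sub>R e1"
    using step(3) digits that[of ?h ?h] that[of ?h ?mh] that[of ?mh ?h]
    by (auto simp: vec_eq_iff)
  have vec: "vector [of_int (2 * w + c), of_int (x + b * w), of_int (y + a * w)]
     = twin_matrix a b *v vector [of_int x, of_int y, of_int w] + (k' - k)"
    unfolding k(3) by (simp add: twin_matrix_mult vec_eq_iff forall_3 vector_3 e1_nth)
  show ?case
  proof (cases "(x, y, w) = (0, 0, 0)")
    case False
    then show ?thesis
      unfolding vec using negligible_overlap_step[OF inv T(2) step(2)[OF False] k(1,2)] by simp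
  next
    case True
    then have "k \<noteq> k'" using step(4) k(3) e1_nonzero by auto
    then have "twin_digits = {k, k'}" using k(1,2) by (auto simp: twin_digits_def)
    then have "negligible (T \<inter> (\<lambda>v. v + (k' - k)) ` T)"
      using T by (intro negligible_overlap_two_digits[OF inv]) (auto simp: det_twin_matrix)
    moreover have "(vector [of_int x, of_int y, of_int w] :: real^3) = 0"
      using True by (simp add: vec_eq_iff forall_3 vector_3)
    ultimately show ?thesis unfolding vec by simp
  qed
qed simp

section \<open>Twindragons are connected symmetric tiles\<close>

lemma twindragon_self_affine:
  assumes "is_twindragon a b T"
  shows "compact T" "T \<noteq> {}" "T = (\<Union>k\<in>twin_digits. (\<lambda>x. matrix_inv (twin_matrix a b) *v (x + k)) ` T)"
proof -
  let ?f = "\<lambda>k x. matrix_inv (twin_matrix a b) *v (x + k)"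
  have "(\<Union>k\<in>twin_digits. ?f k ` S) = (\<lambda>x. matrix_inv (twin_matrix a b) *v (x - (1/2) *\<^sub>R e1)) ` S
    \<union> (\<lambda>x. matrix_inv (twin_matrix a b) *v (x + (1/2) *\<^sub>R e1)) ` S" for S
    by (simp add: twin_digits_def)
  then show "T = (\<Union>k\<in>twin_digits. ?f k ` T)"
    using assms[unfolded is_twindragon_def, THEN conjunct2, THEN conjunct2] by (rule trans[OF _ sym, rotated])
  show "compact T" "T \<noteq> {}"
    using assms[unfolded is_twindragon_def, THEN conjunct1] assms[unfolded is_twindragon_def, THEN conjunct2, THEN conjunct1] .
qed

lemma twindragon_tile:
  assumes ab: "(a, b) \<in> {(0, 1), (2, -2)}" and T: "is_twindragon a b T"
  shows "self_affine_lattice_tile T"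
  unfolding self_affine_lattice_tile_def
  by (intro exI[of _ "twin_matrix a b"] exI[of _ twin_digits] conjI integer_twin_matrix expanding_twin[OF ab] digit_set_twin twindragon_self_affine[OF T])

lemma twindragon_invariant_subset:
  assumes ab: "(a, b) \<in> {(0, 1), (2, -2)}" and T: "is_twindragon a b T"
    and S: "bounded S" "S \<subseteq> (\<Union>k\<in>twin_digits. (\<lambda>x. matrix_inv (twin_matrix a b) *v (x + k)) ` S)"
  shows "S \<subseteq> T"
proof (rule self_affine_attractor[OF _ _ _ _ _ S(2,1)])
  show "linear ((*v) (matrix_inv (twin_matrix a b)))" by (rule matrix_vector_mul_linear)
  show "\<exists>n. \<forall>x. norm (((*v) (matrix_inv (twin_matrix a b)) ^^ n) x) \<le> e * norm x" if "e > 0" for e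
    using expanding_imp_contraction(2)[OF expanding_twin[OF ab] that] .
  show "(\<Union>k\<in>twin_digits. (\<lambda>x. matrix_inv (twin_matrix a b) *v (x + k)) ` T) \<subseteq> T"
    using twindragon_self_affine(3)[OF T] by simp
  show "closed T" "T \<noteq> {}" using twindragon_self_affine[OF T] compact_imp_closed by auto
qed

text \<open>The digits are symmetric, so -T is a bounded subset of its own image and lies in the
  attractor.\<close>

lemma twindragon_symmetric:
  assumes ab: "(a, b) \<in> {(0, 1), (2, -2)}" and T: "is_twindragon a b T"
  shows "uminus ` T = T"
proof -
  let ?L = "\<lambda>x. matrix_inv (twin_matrix a b) *v x"
  have "uminus ` T \<subseteq> T"
  proof (rule twindragon_invariant_subset[OF ab T])
    show "bounded (uminus ` T)" using twindragon_self_affine(1)[OF T] compact_imp_bounded by simp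
    show "uminus ` T \<subseteq> (\<Union>k\<in>twin_digits. (\<lambda>x. ?L (x + k)) ` uminus ` T)"
    proof
      fix v assume "v \<in> uminus ` T"
      then obtain u where "u \<in> T" "v = - u" by blast
      moreover from this obtain x k where "x \<in> T" "k \<in> twin_digits" "u = ?L (x + k)"
        using equalityD1[OF twindragon_self_affine(3)[OF T]] by blast
      ultimately have x: "x \<in> T" "k \<in> twin_digits" "v = - ?L (x + k)" by simp_all
      have "- k \<in> twin_digits" using x(2) by (auto simp: twin_digits_def)
      moreover have "v = ?L (- x + - k)"
        unfolding x(3) linear_neg[OF matrix_vector_mul_linear, symmetric] by simp
      ultimately show "v \<in> (\<Union>k\<in>twin_digits. (\<lambda>x. ?L (x + k)) ` uminus ` T)" using x(1) by blast
    qed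
  qed
  moreover have "T \<subseteq> uminus ` T"
  proof
    fix x assume "x \<in> T"
    then have "- x \<in> T" using calculation by blast
    then show "x \<in> uminus ` T" by (rule image_eqI[rotated]) simp
  qed
  ultimately show ?thesis by blast
qed

text \<open>The members of \<open>P\<close> are twice the actual points, so that the digits become \<open>\<plusminus>1\<close>.\<close>

lemma twindragon_orbit:
  assumes ab: "(a, b) \<in> {(0, 1), (2, -2)}" and T: "is_twindragon a b T"
    and P: "finite P" "\<forall>(x, y, w)\<in>P. \<exists>s\<in>{-1, 1}. (2 * w + s, x + b * w, y + a * w) \<in> P"
    and p: "(x, y, w) \<in> P"
  shows "(1/2) *\<^sub>R vector [of_int x, of_int y, of_int w] \<in> T"
proof -
  define f where "f = (\<lambda>(x, y, w). (1/2) *\<^sub>R (vector [of_int x, of_int y, of_int w] :: real^3))"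
  have inv: "invertible (twin_matrix a b)" by (rule expanding_imp_invertible[OF expanding_twin[OF ab]])
  have "f ` P \<subseteq> T"
  proof (rule twindragon_invariant_subset[OF ab T])
    show "bounded (f ` P)" using P(1) by (simp add: finite_imp_bounded)
    show "f ` P \<subseteq> (\<Union>k\<in>twin_digits. (\<lambda>x. matrix_inv (twin_matrix a b) *v (x + k)) ` f ` P)"
    proof
      fix v assume "v \<in> f ` P"
      then obtain x y w where v: "(x, y, w) \<in> P" "v = f (x, y, w)" by auto
      obtain s where s: "s \<in> {-1, 1}" "(2 * w + s, x + b * w, y + a * w) \<in> P" using P(2) v(1) by blast
      \<comment> \<open>The orbit goes from \<open>v\<close> to M v + (s/2) e1, so the digit of
        \<open>v\<close> has the opposite sign.\<close>
      have "- (of_int s / 2) *\<^sub>R e1 \<in> twin_digits" using s(1) by (auto simp: twin_digits_def)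
      moreover have "twin_matrix a b *v v = f (2 * w + s, x + b * w, y + a * w) + - (of_int s / 2) *\<^sub>R e1"
        unfolding v(2) f_def by (simp add: twin_matrix_mult vec_eq_iff forall_3 vector_3 e1_nth field_simps)
      then have "v = matrix_inv (twin_matrix a b) *v (f (2 * w + s, x + b * w, y + a * w) + - (of_int s / 2) *\<^sub>R e1)"
        by (metis matrix_inv_mul_vector(2)[OF inv])
      ultimately show "v \<in> (\<Union>k\<in>twin_digits. (\<lambda>x. matrix_inv (twin_matrix a b) *v (x + k)) ` f ` P)"
        using s(2) by blast
    qed
  qed
  moreover have "f (x, y, w) \<in> f ` P" using p by (rule imageI)
  ultimately show ?thesis unfolding f_def by auto
qed

lemma twindragon_points:
  assumes ab: "(a, b) \<in> {(0, 1), (2, -2)}" and T: "is_twindragon a b T"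
  shows "0 \<in> T" "\<exists>z\<in>Zlat \<inter> T. z \<noteq> 0"
proof -
  have "0 \<in> T \<and> (\<exists>z\<in>Zlat \<inter> T. z \<noteq> 0)"
  proof (cases "a = 0")
    case True
    then have b: "b = 1" using ab by auto
    \<comment> \<open>Two eventually periodic orbits in doubled coordinates: \<open>(0,0,0)\<close>
      and \<open>(2,-2,0)\<close> each enter a cycle of length 8.\<close>
    define P :: "(int \<times> int \<times> int) set" where
      "P = {(0,0,0), (1,0,0), (-1,1,0), (-1,-1,1), (1,0,-1), (-1,0,0), (1,-1,0), (1,1,-1), (-1,0,1),
        (2,-2,0), (1,2,-2), (-3,-1,2), (3,-1,-1), (-1,2,-1), (-1,-2,2), (3,1,-2), (-3,1,1), (1,-2,1)}"
    have P1: "finite P" by (simp add: P_def)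
    have P2: "\<forall>(x, y, w)\<in>P. \<exists>s\<in>{-1, 1}. (2 * w + s, x + b * w, y + a * w) \<in> P"
      unfolding P_def True b by code_simp
    have "(0, 0, 0) \<in> P" "(2, -2, 0) \<in> P" by (simp_all add: P_def)
    from this[THEN twindragon_orbit[OF ab T P1 P2]]
    have "(1/2) *\<^sub>R vector [0, 0, 0] \<in> T" and z: "(1/2) *\<^sub>R vector [2, -2, 0] \<in> T" by simp_all
    moreover have "(1/2) *\<^sub>R vector [0, 0, 0] = (0 :: real^3)" by (simp add: vec_eq_iff forall_3 vector_3)
    ultimately have "0 \<in> T" by simp
    moreover have "(1/2) *\<^sub>R vector [2, -2, 0] \<in> Zlat" "(1/2) *\<^sub>R vector [2, -2, 0] \<noteq> (0 :: real^3)"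
      by (simp_all add: Zlat_iff vec_eq_iff forall_3 vector_3)
    ultimately show ?thesis using z by (intro conjI bexI IntI)
  next
    case False
    then have a: "a = 2" and b: "b = -2" using ab by auto
    \<comment> \<open>Here \<open>(0,0,0)\<close> ends in the fixed point \<open>(1,-1,1)\<close>,
      and \<open>(-2,4,-2)\<close> in a cycle of length 4.\<close>
    define P :: "(int \<times> int \<times> int) set" where
      "P = {(0,0,0), (1,0,0), (-1,1,0), (1,-1,1),
        (-2,4,-2), (-3,2,0), (1,-3,2), (3,-3,1), (1,1,-1), (-3,3,-1), (-1,-1,1)}"
    have P1: "finite P" by (simp add: P_def)
    have P2: "\<forall>(x, y, w)\<in>P. \<exists>s\<in>{-1, 1}. (2 * w + s, x + b * w, y + a * w) \<in> P"
      unfolding P_def a b by code_simp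
    have "(0, 0, 0) \<in> P" "(-2, 4, -2) \<in> P" by (simp_all add: P_def)
    from this[THEN twindragon_orbit[OF ab T P1 P2]]
    have "(1/2) *\<^sub>R vector [0, 0, 0] \<in> T" and z: "(1/2) *\<^sub>R vector [-2, 4, -2] \<in> T" by simp_all
    moreover have "(1/2) *\<^sub>R vector [0, 0, 0] = (0 :: real^3)" by (simp add: vec_eq_iff forall_3 vector_3)
    ultimately have "0 \<in> T" by simp
    moreover have "(1/2) *\<^sub>R vector [-2, 4, -2] \<in> Zlat" "(1/2) *\<^sub>R vector [-2, 4, -2] \<noteq> (0 :: real^3)"
      by (simp_all add: Zlat_iff vec_eq_iff forall_3 vector_3)
    ultimately show ?thesis using z by (intro conjI bexI IntI)
  qed
  then show "0 \<in> T" "\<exists>z\<in>Zlat \<inter> T. z \<noteq> 0" by auto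
qed

text \<open>Since 0 lies in \<open>T\<close>, the negative of some digit does; by symmetry both
  digits do, so 0 lies in both first-level pieces.\<close>

lemma twindragon_connected:
  assumes ab: "(a, b) \<in> {(0, 1), (2, -2)}" and T: "is_twindragon a b T"
  shows "connected T"
proof (rule self_affine_connected[OF _ _ twindragon_self_affine(3,1)[OF T]])
  let ?L = "\<lambda>x. matrix_inv (twin_matrix a b) *v x"
  show "linear ?L" by (rule matrix_vector_mul_linear)
  show "\<exists>n. \<forall>x. norm ((?L ^^ n) x) \<le> e * norm x" if "e > 0" for e
    using expanding_imp_contraction(2)[OF expanding_twin[OF ab] that] .
  have inv: "invertible (twin_matrix a b)" by (rule expanding_imp_invertible[OF expanding_twin[OF ab]])
  obtain t k where t: "t \<in> T" "k \<in> twin_digits" "0 = ?L (t + k)"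
    using subsetD[OF equalityD1[OF twindragon_self_affine(3)[OF T]] twindragon_points(1)[OF ab T]] by blast
  have "t + k = twin_matrix a b *v ?L (t + k)" by (simp add: matrix_inv_mul_vector[OF inv])
  also have "\<dots> = 0" by (simp add: t(3)[symmetric])
  finally have "t = - k" by (simp add: eq_neg_iff_add_eq_0)
  then have k: "- k \<in> T" using t(1) by simp
  from imageI[OF this, of uminus] have k': "k \<in> T" unfolding twindragon_symmetric[OF ab T] by simp
  have mem: "- d \<in> T" if "d \<in> twin_digits" for d
    using k k' t(2) that by (auto simp: twin_digits_def)
  have "0 \<in> (\<lambda>x. ?L (x + d)) ` T" if "d \<in> twin_digits" for d
    by (rule image_eqI[OF _ mem[OF that]]) simp
  then show "(\<lambda>x. ?L (x + d)) ` T \<inter> (\<lambda>x. ?L (x + d')) ` T \<noteq> {}"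
    if "d \<in> twin_digits" "d' \<in> twin_digits" for d d'
    using that by blast
qed

lemma twindragon_lattice_tiling:
  assumes ab: "(a, b) \<in> {(0, 1), (2, -2)}" and T: "is_twindragon a b T"
  shows "lattice_tiling T"
  unfolding lattice_tiling_def
proof (intro conjI ballI impI)
  show "(\<Union>z\<in>Zlat. (\<lambda>x. x + z) ` T) = UNIV"
    by (rule self_affine_lattice_cover[OF expanding_twin[OF ab] digit_set_twin twindragon_self_affine[OF T]])
  fix z z' assume z: "z \<in> Zlat" "z' \<in> Zlat" "z \<noteq> z'"
  obtain x y w where xyw: "(z' - z)$1 = of_int x" "(z' - z)$2 = of_int y" "(z' - z)$3 = of_int w"
    using Zlat_diff[OF z(2,1)] unfolding Zlat_iff by (metis Ints_cases)
  have d: "z' - z = vector [of_int x, of_int y, of_int w]"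
    by (simp only: vec_eq_iff forall_3 vector_3 xyw simp_thms)
  have "(x, y, w) \<noteq> (0, 0, 0)"
  proof
    assume "(x, y, w) = (0, 0, 0)"
    then have "z' - z = 0" unfolding d by (simp add: vec_eq_iff forall_3 vector_3)
    then show False using z(3) by simp
  qed
  moreover have "twin_rep a b (x, y, w)" using ab twin_rep_01 twin_rep_2m2 by auto
  ultimately have "negligible (T \<inter> (\<lambda>v. v + (z' - z)) ` T)"
    unfolding d using twin_overlap_negligible[OF expanding_imp_invertible[OF expanding_twin[OF ab]]]
      twindragon_self_affine[OF T] by blast
  then show "interior ((\<lambda>x. x + z) ` T) \<inter> interior ((\<lambda>x. x + z') ` T) = {}"
    by (rule negligible_overlap_interiors_disjoint)
qed

text \<open>With a nonzero lattice point z in \<open>T\<close>, the translate T - z contains 0 but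
  must avoid the interior of \<open>T\<close>.\<close>

lemma twindragon_center_not_interior:
  assumes ab: "(a, b) \<in> {(0, 1), (2, -2)}" and T: "is_twindragon a b T"
  shows "0 \<notin> interior T"
proof
  assume 0: "0 \<in> interior T"
  obtain z where z: "z \<in> Zlat" "z \<in> T" "z \<noteq> 0" using twindragon_points(2)[OF ab T] by blast
  note tiling = twindragon_lattice_tiling[OF ab T]
  have "interior T \<inter> (\<lambda>x. x + - z) ` T = {}"
    using z by (intro tile_translate_disjoint tiling tile_regular_closed[OF twindragon_tile[OF ab T]] Zlat_minus) auto
  moreover have "0 \<in> (\<lambda>x. x + - z) ` T" by (rule image_eqI[OF _ z(2)]) simp
  ultimately show False using 0 by blast
qed

lemma twindragon_interior_not_simply_connected:
  assumes ab: "(a, b) \<in> {(0, 1), (2, -2)}" and T: "is_twindragon a b T"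
  shows "\<not> simply_connected (interior T)"
proof (rule symmetric_tile_interior_not_simply_connected[of T 0])
  show "(\<lambda>x. 2 *\<^sub>R 0 - x) ` T = T" using twindragon_symmetric[OF ab T] by simp
qed (rule twindragon_tile[OF ab T] twindragon_connected[OF ab T] twindragon_lattice_tiling[OF ab T]
    twindragon_center_not_interior[OF ab T])+

text \<open>By invariance of domain homeomorphic sets of equal dimension have homeomorphic
  interiors, and the open ball is convex.\<close>

lemma not_simply_connected_interior_imp_not_ball:
  fixes T :: "'a::euclidean_space set"
  assumes "\<not> simply_connected (interior T)"
  shows "\<not> T homeomorphic (cball (0::'a) 1)"
proof
  assume "T homeomorphic (cball (0::'a) 1)"
  moreover have "interior T \<noteq> {}" using assms by auto
  ultimately have "interior T homeomorphic interior (cball (0::'a) 1)"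
    by (intro homeomorphic_interiors) auto
  then have "simply_connected (interior T) \<longleftrightarrow> simply_connected (ball (0::'a) 1)"
    unfolding interior_cball by (rule homeomorphic_simply_connected_eq)
  then show False using assms by (simp add: convex_imp_simply_connected)
qed

theorem theorem12p2:
  shows "(\<forall>(T :: (real^3) set) c.
            self_affine_lattice_tile T \<and> connected T \<and> lattice_tiling T \<and>
            (\<lambda>x. 2 *\<^sub>R c - x) ` T = T \<and> c \<notin> interior T
            \<longrightarrow> \<not> simply_connected (interior T))
       \<and> (\<forall>(a :: int) (b :: int) (T :: (real^3) set).
            (a, b) \<in> {(0, 1), (2, -2)} \<and> is_twindragon a b T
            \<longrightarrow> \<not> simply_connected (interior T)
                \<and> \<not> (T homeomorphic (cball (0 :: real^3) 1)))"
proof (intro conjI allI impI; elim conjE)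
  fix T :: "(real^3) set" and c
  assume "self_affine_lattice_tile T" "connected T" "lattice_tiling T"
    "(\<lambda>x. 2 *\<^sub>R c - x) ` T = T" "c \<notin> interior T"
  then show "\<not> simply_connected (interior T)"
    by (rule symmetric_tile_interior_not_simply_connected)
next
  fix a b :: int and T :: "(real^3) set"
  assume "(a, b) \<in> {(0, 1), (2, -2)}" "is_twindragon a b T"
  then show "\<not> simply_connected (interior T)"
    by (rule twindragon_interior_not_simply_connected)
  then show "\<not> T homeomorphic (cball (0 :: real^3) 1)"
    by (rule not_simply_connected_interior_imp_not_ball)
qed

end
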